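(* Let $I_1,\dots,I_r$ be monomial ideals of $R=\mathbb{K}[x_1,\dots,x_n]$, with $I_i$ minimally generated by monomials $f_{i,1},\dots,f_{i,\mu_i}$ all of the same degree $d_i$, and assume that $I_1,\dots,I_r$ satisfy the strong $\ell$-exchange property. Let $\mathcal{H}$ be the collection of binomials $x_{k_1}T_{i,j}-x_{k_2}T_{i,j'}\in S$ (with $i\in[r]$, $j,j'\in[\mu_i]$, $k_1,k_2\in[n]$) such that $x_{k_1}f_{i,j}=x_{k_2}f_{i,j'}$, $k_1<k_2$, and $k_2$ is the largest index for which $x_{k_1}f_{i,j}/x_{k_2}$ belongs to $I_i$. Suppose that $\mathcal{G}$ is a Gröbner basis of the special fiber ideal $\mathcal{K}\subset T$ with respect to a monomial order $\tau$ on $T$. Then $\mathcal{G}'=\mathcal{H}\cup\mathcal{G}$ is a Gröbner basis of the Rees ideal $\mathcal{J}\subset S$ with respect to an extended monomial order $\tau'$ on $S$ such that $\tau'|_{T}=\tau$ (i.e. such a monomial order $\tau'$ exists). In addition, if $\mathcal{G}$ is a reduced Gröbner basis (with respect to $\tau$), then so is $\mathcal{G}'$ (with respect to $\tau'$).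
   Context: Notation: $[p]=\{1,\dots,p\}$ and $\mathbb{N}$ is the set of non-negative integers. $\mathbb{K}$ is a field, $R=\mathbb{K}[x_1,\dots,x_n]$ carries the lexicographic order with $x_1>\cdots>x_n$, and $r$ is a positive integer. For each $i\in[r]$, $\{f_{i,1},\dots,f_{i,\mu_i}\}$ is the minimal monomial generating set of the monomial ideal $I_i$, with $\deg(f_{i,j})=d_i$ for all $j\in[\mu_i]$ and $f_{i,1}>_{lex}\cdots>_{lex}f_{i,\mu_i}$. Put $S=R[T_{i,j}: i\in[r], j\in[\mu_i]]$ and $T=\mathbb{K}[T_{i,j}: i\in[r], j\in[\mu_i]]\subset S$. The multi-Rees algebra is $\mathcal{R}(I_1\oplus\cdots\oplus I_r)=\bigoplus_{(a_1,\dots,a_r)\in\mathbb{N}^r} I_1^{a_1}\cdots I_r^{a_r}t_1^{a_1}\cdots t_r^{a_r}\subseteq R[t_1,\dots,t_r]$. The Rees ideal $\mathcal{J}$ is the kernel of the $R$-algebra homomorphism $\phi:S\to\mathcal{R}(I_1\oplus\cdots\oplus I_r)$, $T_{i,j}\mapsto f_{i,j}t_i$. The special fiber ring is $\mathcal{F}(I_1\oplus\cdots\oplus I_r)=\mathcal{R}(I_1\oplus\cdots\oplus I_r)\otimes_R\mathbb{K}\cong\mathbb{K}[f_{i,j}t_i: i\in[r], j\in[\mu_i]]$, and the special fiber ideal $\mathcal{K}$ is the kernel of the $\mathbb{K}$-algebra homomorphism $T\to\mathbb{K}[f_{i,j}t_i: i\in[r], j\in[\mu_i]]$, $T_{i,j}\mapsto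 f_{i,j}t_i$. Strong $\ell$-exchange property: $I_1,\dots,I_r$ satisfy it if for every $(w_1,\dots,w_r)\in\mathbb{N}^r$ and any monomials $u=\prod_{i=1}^r\prod_{j=1}^{w_i}f_{i,\alpha_{i,j}}$ and $v=\prod_{i=1}^r\prod_{j=1}^{w_i}f_{i,\beta_{i,j}}$ satisfying, for some $q\le n-1$, (i) $\deg_{x_t}(u)=\deg_{x_t}(v)$ for $t=1,\dots,q-1$ and (ii) $\deg_{x_q}(u)<\deg_{x_q}(v)$, there exist a factor $f_{i,\alpha_{i,j}}$ of $u$ (in the given product) and an integer $q'$ with $q<q'\le n$ such that $x_qf_{i,\alpha_{i,j}}/x_{q'}\in I_i$. Here "belongs to $I_i$" for a quotient of monomials includes that the quotient is a monomial of $R$. *)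

theory Defs
  imports
    "HOL-Library.Poly_Mapping"
    "HOL-Algebra.Ideal_Product"
    "HOL-Algebra.Generated_Rings"
begin

text \<open>
  All polynomial rings live inside one polynomial ring over the countable set of indeterminates
  \<open>indet_var\<close>: \<open>Xv k\<close> is $x_k$, \<open>Tv i j\<close> is $T_{i,j}$ and \<open>Yv i\<close> is the Rees variable $t_i$.
  A monomial is identified with its exponent vector, so that products of monomials are
  sums of exponent vectors.  The rings of the text are carved out by restricting
  the indeterminates.
\<close>

datatype indet_var = Xv nat | Tv nat nat | Yv nat

type_synonym mono = "indet_var \<Rightarrow>\<^sub>0 nat"
type_synonym 'k mpoly = "mono \<Rightarrow>\<^sub>0 'k"

definition mons :: "indet_var set \<Rightarrow> mono set" where
  "mons V = {m. Poly_Mapping.keys m \<subseteq> V}"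

definition poly_ring :: "indet_var set \<Rightarrow> 'k::field mpoly ring" where
  "poly_ring V = \<lparr>carrier = {p. Poly_Mapping.keys p \<subseteq> mons V},
     mult = (*), one = 1, zero = 0, add = (+)\<rparr>"

definition const_poly :: "'k::field \<Rightarrow> 'k mpoly" where
  "const_poly c = Poly_Mapping.single 0 c"

definition monomial :: "mono \<Rightarrow> 'k::field mpoly" where
  "monomial m = Poly_Mapping.single m 1"

definition indet :: "indet_var \<Rightarrow> mono" where
  "indet v = Poly_Mapping.single v 1"

definition mdeg :: "mono \<Rightarrow> nat" where
  "mdeg m = (\<Sum>v\<in>Poly_Mapping.keys m. Poly_Mapping.lookup m v)"

definition mdvd :: "mono \<Rightarrow> mono \<Rightarrow> bool" where
  "mdvd u v \<longleftrightarrow> (\<exists>w. v = u + w)"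

definition Xvars :: "nat \<Rightarrow> indet_var set" where
  "Xvars n = Xv ` {1..n}"

definition Tvars :: "nat \<Rightarrow> (nat \<Rightarrow> nat) \<Rightarrow> indet_var set" where
  "Tvars r \<mu> = {Tv i j | i j. i \<in> {1..r} \<and> j \<in> {1..\<mu> i}}"

definition Yvars :: "nat \<Rightarrow> indet_var set" where
  "Yvars r = Yv ` {1..r}"

definition lex_less :: "nat \<Rightarrow> mono \<Rightarrow> mono \<Rightarrow> bool" where
  "lex_less n u v \<longleftrightarrow> (\<exists>q\<in>{1..n}.
     (\<forall>t\<in>{1..<q}. Poly_Mapping.lookup u (Xv t) = Poly_Mapping.lookup v (Xv t)) \<and>
     Poly_Mapping.lookup u (Xv q) < Poly_Mapping.lookup v (Xv q))"

definition minimal_monomial_gens :: "indet_var set \<Rightarrow> 'k::field mpoly set \<Rightarrow> 'k mpoly set \<Rightarrow> bool" where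
  "minimal_monomial_gens V I B \<longleftrightarrow>
     B \<subseteq> monomial ` mons V \<and> I = Idl\<^bsub>poly_ring V\<^esub> B \<and>
     (\<forall>B'. B' \<subset> B \<longrightarrow> Idl\<^bsub>poly_ring V\<^esub> B' \<noteq> I)"

text \<open>\<open>quot_in n I m k\<close>: the quotient $m / x_k$ is a monomial of $R$ belonging to \<open>I\<close>.\<close>

definition quot_in :: "nat \<Rightarrow> 'k::field mpoly set \<Rightarrow> mono \<Rightarrow> nat \<Rightarrow> bool" where
  "quot_in n I m k \<longleftrightarrow> (\<exists>g\<in>mons (Xvars n). g + indet (Xv k) = m \<and> monomial g \<in> I)"

definition strong_l_exchange ::
  "nat \<Rightarrow> nat \<Rightarrow> (nat \<Rightarrow> nat) \<Rightarrow> (nat \<Rightarrow> nat \<Rightarrow> mono) \<Rightarrow> (nat \<Rightarrow> 'k::field mpoly set) \<Rightarrow> bool" where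
  "strong_l_exchange n r \<mu> f I \<longleftrightarrow>
     (\<forall>(w :: nat \<Rightarrow> nat) (\<alpha> :: nat \<Rightarrow> nat \<Rightarrow> nat) (\<beta> :: nat \<Rightarrow> nat \<Rightarrow> nat) u v. \<forall>q\<in>{1..n - 1}.
        (\<forall>i\<in>{1..r}. \<forall>j\<in>{1..w i}. \<alpha> i j \<in> {1..\<mu> i} \<and> \<beta> i j \<in> {1..\<mu> i}) \<longrightarrow>
        u = (\<Sum>i\<in>{1..r}. \<Sum>j\<in>{1..w i}. f i (\<alpha> i j)) \<longrightarrow>
        v = (\<Sum>i\<in>{1..r}. \<Sum>j\<in>{1..w i}. f i (\<beta> i j)) \<longrightarrow>
        (\<forall>t\<in>{1..q - 1}. Poly_Mapping.lookup u (Xv t) = Poly_Mapping.lookup v (Xv t)) \<longrightarrow>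
        Poly_Mapping.lookup u (Xv q) < Poly_Mapping.lookup v (Xv q) \<longrightarrow>
        (\<exists>i\<in>{1..r}. \<exists>j\<in>{1..w i}. \<exists>q'\<in>{q<..n}.
           quot_in n (I i) (indet (Xv q) + f i (\<alpha> i j)) q'))"

text \<open>The product $I_1^{a_1}\cdots I_r^{a_r}$, where $a_i$ is the exponent of $t_i$ in \<open>a\<close>.\<close>

definition ideal_power_prod ::
  "nat \<Rightarrow> nat \<Rightarrow> (nat \<Rightarrow> 'k::field mpoly set) \<Rightarrow> mono \<Rightarrow> 'k mpoly set" where
  "ideal_power_prod n r I a =
     (let M = ideals_set (poly_ring (Xvars n) :: 'k mpoly ring)
      in finprod M (\<lambda>i. I i [^]\<^bsub>M\<^esub> Poly_Mapping.lookup a (Yv i)) {1..r})"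

definition rees_algebra ::
  "nat \<Rightarrow> nat \<Rightarrow> (nat \<Rightarrow> 'k::field mpoly set) \<Rightarrow> 'k mpoly ring" where
  "rees_algebra n r I = (poly_ring (Xvars n \<union> Yvars r))
     \<lparr>carrier := {\<Sum>a\<in>A. c a * monomial a | A c.
        finite A \<and> A \<subseteq> mons (Yvars r) \<and> (\<forall>a\<in>A. c a \<in> ideal_power_prod n r I a)}\<rparr>"

text \<open>The special fiber ring is taken in the form $\mathbb{K}[f_{i,j}t_i]$.\<close>

definition special_fiber_ring ::
  "nat \<Rightarrow> nat \<Rightarrow> (nat \<Rightarrow> nat) \<Rightarrow> (nat \<Rightarrow> nat \<Rightarrow> mono) \<Rightarrow> 'k::field mpoly ring" where
  "special_fiber_ring n r \<mu> f = (poly_ring (Xvars n \<union> Yvars r))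
     \<lparr>carrier := generate_ring (poly_ring (Xvars n \<union> Yvars r))
        (range const_poly \<union> {monomial (f i j + indet (Yv i)) | i j. i \<in> {1..r} \<and> j \<in> {1..\<mu> i}})\<rparr>"

definition poly_subst :: "(indet_var \<Rightarrow> 'k::field mpoly) \<Rightarrow> 'k mpoly \<Rightarrow> 'k mpoly" where
  "poly_subst \<sigma> p = (\<Sum>m\<in>Poly_Mapping.keys p.
     const_poly (Poly_Mapping.lookup p m) *
     (\<Prod>v\<in>Poly_Mapping.keys m. \<sigma> v ^ Poly_Mapping.lookup m v))"

text \<open>
  The homomorphism $x_k \mapsto x_k$, $T_{i,j} \mapsto f_{i,j}t_i$; the value at \<open>Yv i\<close> is
  irrelevant.  Restricted to \<open>T\<close> it is the homomorphism defining the special fiber ideal.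
\<close>

definition rees_map :: "(nat \<Rightarrow> nat \<Rightarrow> mono) \<Rightarrow> 'k::field mpoly \<Rightarrow> 'k mpoly" where
  "rees_map f = poly_subst (\<lambda>v. case v of
       Xv k \<Rightarrow> monomial (indet (Xv k))
     | Tv i j \<Rightarrow> monomial (f i j + indet (Yv i))
     | Yv i \<Rightarrow> monomial (indet (Yv i)))"

definition rees_ideal ::
  "nat \<Rightarrow> nat \<Rightarrow> (nat \<Rightarrow> nat) \<Rightarrow> (nat \<Rightarrow> nat \<Rightarrow> mono) \<Rightarrow> (nat \<Rightarrow> 'k::field mpoly set) \<Rightarrow> 'k mpoly set" where
  "rees_ideal n r \<mu> f I =
     a_kernel (poly_ring (Xvars n \<union> Tvars r \<mu>)) (rees_algebra n r I) (rees_map f)"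

definition special_fiber_ideal ::
  "nat \<Rightarrow> nat \<Rightarrow> (nat \<Rightarrow> nat) \<Rightarrow> (nat \<Rightarrow> nat \<Rightarrow> mono) \<Rightarrow> 'k::field mpoly set" where
  "special_fiber_ideal n r \<mu> f =
     a_kernel (poly_ring (Tvars r \<mu>)) (special_fiber_ring n r \<mu> f) (rees_map f)"

text \<open>A pair \<open>(u, v)\<close> in the relation means $u \le v$.\<close>

definition monomial_order :: "indet_var set \<Rightarrow> mono rel \<Rightarrow> bool" where
  "monomial_order V \<tau> \<longleftrightarrow>
     linear_order_on (mons V) \<tau> \<and>
     (\<forall>u\<in>mons V. (0, u) \<in> \<tau>) \<and>
     (\<forall>u v. \<forall>w\<in>mons V. (u, v) \<in> \<tau> \<longrightarrow> (u + w, v + w) \<in> \<tau>)"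

definition lead_mon :: "mono rel \<Rightarrow> 'k::field mpoly \<Rightarrow> mono" where
  "lead_mon \<tau> p = (THE m. m \<in> Poly_Mapping.keys p \<and> (\<forall>m'\<in>Poly_Mapping.keys p. (m', m) \<in> \<tau>))"

text \<open>
  Groebner bases are finite sets of nonzero polynomials; the empty set is the
  Groebner basis of the zero ideal.
\<close>

definition groebner_basis ::
  "indet_var set \<Rightarrow> mono rel \<Rightarrow> 'k::field mpoly set \<Rightarrow> 'k mpoly set \<Rightarrow> bool" where
  "groebner_basis V \<tau> J G \<longleftrightarrow>
     finite G \<and> G \<subseteq> J \<and> 0 \<notin> G \<and>
     Idl\<^bsub>poly_ring V :: 'k mpoly ring\<^esub> ((\<lambda>p. monomial (lead_mon \<tau> p)) ` (J - {0})) =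
     Idl\<^bsub>poly_ring V :: 'k mpoly ring\<^esub> ((\<lambda>g. monomial (lead_mon \<tau> g)) ` G)"

definition reduced_groebner_basis ::
  "indet_var set \<Rightarrow> mono rel \<Rightarrow> 'k::field mpoly set \<Rightarrow> 'k mpoly set \<Rightarrow> bool" where
  "reduced_groebner_basis V \<tau> J G \<longleftrightarrow>
     groebner_basis V \<tau> J G \<and>
     (\<forall>g\<in>G. Poly_Mapping.lookup g (lead_mon \<tau> g) = 1) \<and>
     (\<forall>g\<in>G. \<forall>h\<in>G - {g}. \<forall>m\<in>Poly_Mapping.keys g. \<not> mdvd (lead_mon \<tau> h) m)"

text \<open>
  The maximum below is over a nonempty set, as $k_1$ belongs to it.
\<close>

definition exchange_binomials ::
  "nat \<Rightarrow> nat \<Rightarrow> (nat \<Rightarrow> nat) \<Rightarrow> (nat \<Rightarrow> nat \<Rightarrow> mono) \<Rightarrow> (nat \<Rightarrow> 'k::field mpoly set) \<Rightarrow> 'k mpoly set" where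
  "exchange_binomials n r \<mu> f I =
     {monomial (indet (Xv k1)) * monomial (indet (Tv i j)) - monomial (indet (Xv k2)) * monomial (indet (Tv i j')) |
        i j j' k1 k2.
        i \<in> {1..r} \<and> j \<in> {1..\<mu> i} \<and> j' \<in> {1..\<mu> i} \<and> k1 \<in> {1..n} \<and> k2 \<in> {1..n} \<and>
        indet (Xv k1) + f i j = indet (Xv k2) + f i j' \<and> k1 < k2 \<and>
        k2 = Max {k \<in> {1..n}. quot_in n (I i) (indet (Xv k1) + f i j) k}}"

end

theory Submission
  imports Defs
begin

text \<open>
  Take \<open>\<tau>'\<close> to compare the $x$-parts lexicographically first and to break ties by \<open>\<tau>\<close> on the
  $T$-parts.  If $m$ is the leading monomial of an element of the Rees ideal, then that element
  contains a second monomial $m' < m$ with the same image.  If $m$ and $m'$ have the same $x$-part,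
  their $T$-parts differ by an element of the special fiber ideal, so a leading monomial of \<open>G\<close>
  divides $m$.  Otherwise let $q$ be the first index where the $x$-parts differ.  The images of the
  two $T$-parts then satisfy the hypotheses of the strong $\ell$-exchange property at $q$ (equality of
  total degrees excludes $q = n$), and the exchangeable factor $T_{i,j}$ of $m$ yields the leading monomial
  $x_q T_{i,j}$ of an exchange binomial, which divides $m$.

  For reducedness, the maximality of $k_2$ prevents $x_{k_2} T_{i,j'}$ from being the leading
  monomial of another exchange binomial, and the leading monomials of \<open>G\<close> do not divide the
  terms of exchange binomials because the $f_{i,j}$ are distinct.
\<close>

section \<open>Monomials and monomial ideals\<close>

lemma zero_in_mons [simp]: "0 \<in> mons V"
  by (simp add: mons_def)

lemma keys_add_mono: "Poly_Mapping.keys (u + v :: mono) = Poly_Mapping.keys u \<union> Poly_Mapping.keys v"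
  by (auto simp: in_keys_iff lookup_add)

lemma mons_add_iff [simp]: "u + v \<in> mons V \<longleftrightarrow> u \<in> mons V \<and> v \<in> mons V"
  by (simp add: mons_def keys_add_mono)

lemma mons_sum: "(\<And>a. a \<in> A \<Longrightarrow> s a \<in> mons V) \<Longrightarrow> sum s A \<in> mons V"
  by (induction A rule: infinite_finite_induct) auto

lemma mons_mono: "V \<subseteq> W \<Longrightarrow> mons V \<subseteq> mons W"
  by (auto simp: mons_def)

lemma lookup_eq_0_if_mons: "u \<in> mons V \<Longrightarrow> v \<notin> V \<Longrightarrow> Poly_Mapping.lookup u v = 0"
  by (auto simp: mons_def in_keys_iff)

lemma lookup_indet: "Poly_Mapping.lookup (indet v) x = (if x = v then 1 else 0)"
  by (simp add: indet_def lookup_single when_def eq_commute)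

lemma indet_in_mons [simp]: "indet v \<in> mons V \<longleftrightarrow> v \<in> V"
  by (simp add: mons_def indet_def)

lemma mdvd_iff_lookup_le:
  "mdvd u v \<longleftrightarrow> (\<forall>x. Poly_Mapping.lookup u x \<le> Poly_Mapping.lookup v x)"
proof
  assume *: "\<forall>x. Poly_Mapping.lookup u x \<le> Poly_Mapping.lookup v x"
  have "v = u + (v - u)"
    by (rule poly_mapping_eqI) (use * in \<open>simp add: lookup_add lookup_minus\<close>)
  then show "mdvd u v" by (auto simp: mdvd_def)
qed (clarsimp simp: mdvd_def lookup_add)

lemma mdvd_refl [simp]: "mdvd u u"
  by (simp add: mdvd_iff_lookup_le)

lemma mdvd_trans: "mdvd u v \<Longrightarrow> mdvd v w \<Longrightarrow> mdvd u w"
  by (meson mdvd_iff_lookup_le order_trans)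

lemma mdvd_add: "mdvd u v \<Longrightarrow> mdvd u (w + v)"
  by (simp add: mdvd_iff_lookup_le lookup_add trans_le_add2)

lemma mdvd_in_mons: "mdvd u v \<Longrightarrow> v \<in> mons V \<Longrightarrow> u \<in> mons V"
  by (auto simp: mdvd_def)

lemma mdeg_superset:
  "finite A \<Longrightarrow> Poly_Mapping.keys u \<subseteq> A \<Longrightarrow> mdeg u = (\<Sum>v\<in>A. Poly_Mapping.lookup u v)"
  unfolding mdeg_def by (rule sum.mono_neutral_left) (auto simp: in_keys_iff)

lemma mdeg_add: "mdeg (u + v) = mdeg u + mdeg v"
  using mdeg_superset[of "Poly_Mapping.keys (u + v)" u] mdeg_superset[of "Poly_Mapping.keys (u + v)" v]
  by (simp add: mdeg_def keys_add_mono lookup_add sum.distrib)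

lemma mdeg_indet [simp]: "mdeg (indet v) = 1"
  by (simp add: mdeg_def indet_def)

lemma mdeg_eq_0_iff [simp]: "mdeg u = 0 \<longleftrightarrow> u = 0"
  by (auto simp: mdeg_def in_keys_iff) (auto simp: in_keys_iff poly_mapping_eq_iff fun_eq_iff)

lemma mdeg_sum: "mdeg (sum s A) = (\<Sum>a\<in>A. mdeg (s a))"
  by (induction A rule: infinite_finite_induct) (auto simp: mdeg_add)

section \<open>Polynomial rings and ideals generated by monomials\<close>

lemma keys_monomial [simp]: "Poly_Mapping.keys (monomial u :: 'k::field mpoly) = {u}"
  by (simp add: monomial_def)

lemma lookup_monomial:
  "Poly_Mapping.lookup (monomial u :: 'k::field mpoly) x = (if x = u then 1 else 0)"
  by (simp add: monomial_def lookup_single when_def eq_commute)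

lemma monomial_mult: "monomial u * monomial v = (monomial (u + v) :: 'k::field mpoly)"
  by (simp add: monomial_def mult_single)

lemma keys_binomial:
  "u \<noteq> v \<Longrightarrow> Poly_Mapping.keys (monomial u - monomial v :: 'k::field mpoly) = {u, v}"
  by (auto simp: in_keys_iff lookup_minus lookup_monomial split: if_splits)

lemma poly_ring_simps [simp]:
  "carrier (poly_ring V) = {p. Poly_Mapping.keys p \<subseteq> mons V}"
  "mult (poly_ring V) = (*)"
  "one (poly_ring V) = 1"
  "zero (poly_ring V) = 0"
  "add (poly_ring V) = (+)"
  by (simp_all add: poly_ring_def)

lemma keys_mult_mons:
  "Poly_Mapping.keys p \<subseteq> mons V \<Longrightarrow> Poly_Mapping.keys q \<subseteq> mons V \<Longrightarrow>
   Poly_Mapping.keys (p * q :: 'k::field mpoly) \<subseteq> mons V"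
  using keys_mult[of p q] mons_add_iff[of _ _ V] by blast

lemma keys_add_subset:
  "Poly_Mapping.keys p \<subseteq> A \<Longrightarrow> Poly_Mapping.keys q \<subseteq> A \<Longrightarrow>
   Poly_Mapping.keys (p + q :: 'k::field mpoly) \<subseteq> A"
  using Poly_Mapping.keys_add[of p q] by blast

lemma keys_uminus_mpoly [simp]: "Poly_Mapping.keys (- p :: 'k::field mpoly) = Poly_Mapping.keys p"
  by (auto simp: in_keys_iff)

lemma poly_ring_ring: "ring (poly_ring V :: 'k::field mpoly ring)"
proof (rule ringI)
  show "abelian_group (poly_ring V :: 'k mpoly ring)"
  proof (rule abelian_groupI)
    fix p assume "p \<in> carrier (poly_ring V :: 'k mpoly ring)"
    then show "\<exists>y\<in>carrier (poly_ring V). y \<oplus>\<^bsub>poly_ring V\<^esub> p = \<zero>\<^bsub>poly_ring V\<^esub>"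
      by (intro bexI[of _ "- p"]) auto
  qed (simp_all add: add.assoc add.commute keys_add_subset)
  show "Group.monoid (poly_ring V :: 'k mpoly ring)"
    by (rule monoidI) (simp_all add: mult.assoc keys_mult_mons)
qed (simp_all add: algebra_simps)

text \<open>A term of \<open>q * p\<close> is a product of a term of \<open>q\<close> and a term of
  \<open>p\<close>, so divisibility by a member of \<open>B\<close> survives multiplication. This
  ideal serves as an upper bound for the ideal generated by the monomials in
  \<open>B\<close>.\<close>

lemma ideal_keys_divisible:
  "ideal {p :: 'k::field mpoly. Poly_Mapping.keys p \<subseteq> mons V \<and> (\<forall>m\<in>Poly_Mapping.keys p. \<exists>b\<in>B. mdvd b m)}
     (poly_ring V)" (is "ideal ?I _")
proof (rule idealI[OF poly_ring_ring])
  interpret R: ring "poly_ring V :: 'k mpoly ring" by (rule poly_ring_ring)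
  have minus: "\<ominus>\<^bsub>poly_ring V\<^esub> p = - p" if "Poly_Mapping.keys p \<subseteq> mons V" for p :: "'k mpoly"
    by (rule R.minus_equality) (use that in auto)
  show "subgroup ?I (add_monoid (poly_ring V))"
  proof (rule R.add.subgroupI)
    fix p q assume "p \<in> ?I" "q \<in> ?I"
    then show "p \<oplus>\<^bsub>poly_ring V\<^esub> q \<in> ?I"
      using Poly_Mapping.keys_add[of p q] by (simp, blast)
  next
    fix p assume "p \<in> ?I"
    then show "\<ominus>\<^bsub>poly_ring V\<^esub> p \<in> ?I" by (simp add: minus)
  \<comment> \<open>The zero polynomial shows that the set is nonempty.\<close>
  qed (auto intro!: exI[of _ 0])
next
  fix p q assume p: "p \<in> ?I" and q: "q \<in> carrier (poly_ring V :: 'k mpoly ring)"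
  have "\<exists>b\<in>B. mdvd b m" if "m \<in> Poly_Mapping.keys (q * p)" for m
  proof -
    from keys_mult[of q p] that obtain a c where "m = a + c" "c \<in> Poly_Mapping.keys p" by blast
    with p show ?thesis using mdvd_add by blast
  qed
  with p q show "q \<otimes>\<^bsub>poly_ring V\<^esub> p \<in> ?I" by (simp add: keys_mult_mons)
  then show "p \<otimes>\<^bsub>poly_ring V\<^esub> q \<in> ?I" by (simp add: mult.commute)
qed

text \<open>Minimality of the generated ideal against \<open>ideal_keys_divisible\<close> gives one
  direction, multiplication by the complementary monomial the other. From here on, membership of
  monomials becomes divisibility of exponent vectors.\<close>

lemma monomial_in_Idl_iff:
  assumes "B \<subseteq> mons V"
  shows "(monomial m :: 'k::field mpoly) \<in> Idl\<^bsub>poly_ring V\<^esub> (monomial ` B) \<longleftrightarrow>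
    m \<in> mons V \<and> (\<exists>b\<in>B. mdvd b m)"
proof
  let ?I = "{p :: 'k mpoly. Poly_Mapping.keys p \<subseteq> mons V \<and> (\<forall>m\<in>Poly_Mapping.keys p. \<exists>b\<in>B. mdvd b m)}"
  interpret R: ring "poly_ring V :: 'k mpoly ring" by (rule poly_ring_ring)
  have "Idl\<^bsub>poly_ring V\<^esub> (monomial ` B) \<subseteq> ?I"
    by (rule R.genideal_minimal[OF ideal_keys_divisible]) (use assms in \<open>auto intro: mdvd_refl\<close>)
  moreover assume "monomial m \<in> Idl\<^bsub>poly_ring V :: 'k mpoly ring\<^esub> (monomial ` B)"
  ultimately show "m \<in> mons V \<and> (\<exists>b\<in>B. mdvd b m)" by auto
next
  interpret R: ring "poly_ring V :: 'k mpoly ring" by (rule poly_ring_ring)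
  assume "m \<in> mons V \<and> (\<exists>b\<in>B. mdvd b m)"
  then obtain b w where bw: "b \<in> B" "m = b + w" "w \<in> mons V"
    by (auto simp: mdvd_def)
  have sub: "monomial ` B \<subseteq> carrier (poly_ring V :: 'k mpoly ring)" using assms by auto
  interpret J: ideal "Idl\<^bsub>poly_ring V\<^esub> (monomial ` B)" "poly_ring V :: 'k mpoly ring"
    by (rule R.genideal_ideal[OF sub])
  have "monomial b \<in> Idl\<^bsub>poly_ring V :: 'k mpoly ring\<^esub> (monomial ` B)"
    using R.genideal_self[OF sub] bw by auto
  from J.I_r_closed[OF this, of "monomial w"] bw
  show "(monomial m :: 'k mpoly) \<in> Idl\<^bsub>poly_ring V\<^esub> (monomial ` B)"
    by (simp add: monomial_mult)
qed

text \<open>Each of the two generating sets lies in the ideal generated by the other.\<close>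

lemma Idl_monomials_eqI:
  assumes "A \<subseteq> mons V" "B \<subseteq> A" "\<And>a. a \<in> A \<Longrightarrow> \<exists>b\<in>B. mdvd b a"
  shows "Idl\<^bsub>poly_ring V :: 'k::field mpoly ring\<^esub> (monomial ` A) = Idl\<^bsub>poly_ring V\<^esub> (monomial ` B)"
proof -
  interpret R: ring "poly_ring V :: 'k mpoly ring" by (rule poly_ring_ring)
  have car: "monomial ` A \<subseteq> carrier (poly_ring V :: 'k mpoly ring)"
            "monomial ` B \<subseteq> carrier (poly_ring V :: 'k mpoly ring)"
    using assms by auto
  have "monomial ` A \<subseteq> Idl\<^bsub>poly_ring V :: 'k mpoly ring\<^esub> (monomial ` B)"
    using assms by (auto simp: monomial_in_Idl_iff[of B V])
  moreover have "monomial ` B \<subseteq> Idl\<^bsub>poly_ring V :: 'k mpoly ring\<^esub> (monomial ` A)"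
    using R.genideal_self[OF car(1)] assms(2) by auto
  ultimately show ?thesis
    by (meson R.genideal_ideal R.genideal_minimal car subset_antisym)
qed

section \<open>Leading monomials\<close>

text \<open>Antisymmetry makes the greatest term unique, so the description operator in
  \<open>lead_mon\<close> can be evaluated.\<close>

lemma lead_mon_eqI:
  assumes "monomial_order V \<tau>" "m \<in> Poly_Mapping.keys p" "\<And>m'. m' \<in> Poly_Mapping.keys p \<Longrightarrow> (m', m) \<in> \<tau>"
  shows "lead_mon \<tau> p = m"
  unfolding lead_mon_def
  using assms by (intro the_equality)
    (auto simp: monomial_order_def order_on_defs intro: antisymD)

text \<open>A total order has a greatest element on every finite nonempty set, in particular on the
  support of a nonzero polynomial.\<close>

lemma lead_mon_max:
  assumes \<tau>: "monomial_order V \<tau>" and "p \<noteq> 0" "Poly_Mapping.keys p \<subseteq> mons V"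
  shows "lead_mon \<tau> p \<in> Poly_Mapping.keys p \<and> (\<forall>m\<in>Poly_Mapping.keys p. (m, lead_mon \<tau> p) \<in> \<tau>)"
proof -
  have lin: "refl_on (mons V) \<tau>" "trans \<tau>" "total_on (mons V) \<tau>"
    using \<tau> by (auto simp: monomial_order_def order_on_defs)
  have "\<exists>m\<in>A. \<forall>m'\<in>A. (m', m) \<in> \<tau>" if "finite A" "A \<noteq> {}" "A \<subseteq> mons V" for A
    using that
  proof (induction A rule: finite_ne_induct)
    case (singleton x)
    then show ?case using lin by (auto simp: refl_on_def)
  next
    case (insert x A)
    then obtain m where m: "m \<in> A" "\<forall>m'\<in>A. (m', m) \<in> \<tau>" by auto
    have "(x, m) \<in> \<tau> \<or> (m, x) \<in> \<tau>" "(x, x) \<in> \<tau>"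
      using lin insert.prems m(1) insert.hyps(3) by (auto simp: total_on_def refl_on_def)
    then show ?case
    proof (elim disjE)
      assume "(m, x) \<in> \<tau>"
      then show ?case using m \<open>(x, x) \<in> \<tau>\<close> transD[OF lin(2)] by blast
    qed (use m in blast)
  qed
  then obtain m where m: "m \<in> Poly_Mapping.keys p" "\<forall>m'\<in>Poly_Mapping.keys p. (m', m) \<in> \<tau>"
    using assms by (meson finite_keys keys_eq_empty)
  with lead_mon_eqI[OF \<tau> m(1)] show ?thesis by auto
qed

lemma lead_mon_binomial:
  assumes "monomial_order V \<tau>" "u \<in> mons V" "(v, u) \<in> \<tau>" "u \<noteq> v"
  shows "lead_mon \<tau> (monomial u - monomial v :: 'k::field mpoly) = u"
  using assms
  by (intro lead_mon_eqI) (auto simp: keys_binomial monomial_order_def order_on_defs refl_on_def)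

text \<open>Both initial ideals are generated by monomials, so by \<open>Idl_monomials_eqI\<close>
  their equality follows from divisibility of leading monomials. The lemma
  \<open>groebner_basisD\<close> is the converse.\<close>

lemma groebner_basisI:
  fixes J :: "'k::field mpoly set"
  assumes \<tau>: "monomial_order V \<tau>"
    and J: "\<And>p. p \<in> J \<Longrightarrow> Poly_Mapping.keys p \<subseteq> mons V"
    and "finite G" "G \<subseteq> J" "0 \<notin> G"
    and div: "\<And>p. p \<in> J \<Longrightarrow> p \<noteq> 0 \<Longrightarrow> \<exists>g\<in>G. mdvd (lead_mon \<tau> g) (lead_mon \<tau> p)"
  shows "groebner_basis V \<tau> J G"
proof -
  have "Idl\<^bsub>poly_ring V :: 'k mpoly ring\<^esub> (monomial ` (lead_mon \<tau> ` (J - {0}))) =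
        Idl\<^bsub>poly_ring V :: 'k mpoly ring\<^esub> (monomial ` (lead_mon \<tau> ` G))"
  proof (rule Idl_monomials_eqI)
    show "lead_mon \<tau> ` (J - {0}) \<subseteq> mons V" using J lead_mon_max[OF \<tau>] by blast
    show "lead_mon \<tau> ` G \<subseteq> lead_mon \<tau> ` (J - {0})" using assms by blast
  qed (use div in auto)
  then show ?thesis using assms by (simp add: groebner_basis_def image_image)
qed

lemma groebner_basisD:
  fixes J :: "'k::field mpoly set"
  assumes \<tau>: "monomial_order V \<tau>"
    and J: "\<And>p. p \<in> J \<Longrightarrow> Poly_Mapping.keys p \<subseteq> mons V"
    and G: "groebner_basis V \<tau> J G" and p: "p \<in> J" "p \<noteq> 0"
  shows "\<exists>g\<in>G. mdvd (lead_mon \<tau> g) (lead_mon \<tau> p)"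
proof -
  interpret R: ring "poly_ring V :: 'k mpoly ring" by (rule poly_ring_ring)
  have sub: "lead_mon \<tau> ` G \<subseteq> mons V" "lead_mon \<tau> ` (J - {0}) \<subseteq> mons V"
  proof -
    show "lead_mon \<tau> ` (J - {0}) \<subseteq> mons V" using J lead_mon_max[OF \<tau>] by blast
    moreover have "G \<subseteq> J - {0}" using G by (auto simp: groebner_basis_def)
    ultimately show "lead_mon \<tau> ` G \<subseteq> mons V" by blast
  qed
  have "monomial (lead_mon \<tau> p) \<in> Idl\<^bsub>poly_ring V :: 'k mpoly ring\<^esub> (monomial ` lead_mon \<tau> ` (J - {0}))"
    using p sub by (subst monomial_in_Idl_iff) (auto intro: mdvd_refl)
  also have "\<dots> = Idl\<^bsub>poly_ring V\<^esub> (monomial ` (lead_mon \<tau> ` G))"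
    using G by (simp add: groebner_basis_def image_image)
  finally show ?thesis using sub by (simp add: monomial_in_Idl_iff)
qed

section \<open>The monomial map on exponent vectors\<close>

text \<open>The homomorphism \<open>rees_map\<close> sends every indeterminate to a monomial; this
  is the exponent vector of that monomial.\<close>

definition rees_var :: "(nat \<Rightarrow> nat \<Rightarrow> mono) \<Rightarrow> indet_var \<Rightarrow> mono" where
  "rees_var f v = (case v of
       Xv k \<Rightarrow> indet (Xv k)
     | Tv i j \<Rightarrow> f i j + indet (Yv i)
     | Yv i \<Rightarrow> indet (Yv i))"

text \<open>The inner sum is a multiple of \<open>rees_var f v\<close>, in the shape in which
  \<open>monomial_power\<close> writes a power of a monomial.\<close>

definition rees_exp :: "(nat \<Rightarrow> nat \<Rightarrow> mono) \<Rightarrow> mono \<Rightarrow> mono" where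
  "rees_exp f m = (\<Sum>v\<in>Poly_Mapping.keys m. \<Sum>_<Poly_Mapping.lookup m v. rees_var f v)"

lemma sum_const_add:
  "(\<Sum>_<a + b. c) = (\<Sum>_<a. c) + (\<Sum>_<b::nat. c :: 'a::comm_monoid_add)"
  by (induction b) (simp_all add: add.assoc)

lemma rees_exp_superset:
  assumes "finite A" "Poly_Mapping.keys m \<subseteq> A"
  shows "rees_exp f m = (\<Sum>v\<in>A. \<Sum>_<Poly_Mapping.lookup m v. rees_var f v)"
  unfolding rees_exp_def using assms
  by (intro sum.mono_neutral_left) (auto simp: in_keys_iff)

lemma rees_exp_0 [simp]: "rees_exp f 0 = 0"
  by (simp add: rees_exp_def)

lemma rees_exp_add: "rees_exp f (u + v) = rees_exp f u + rees_exp f v"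
proof -
  let ?K = "Poly_Mapping.keys (u + v)"
  \<comment> \<open>The three supports may differ, so all sums are first extended to the support of
    \<open>u + v\<close>.\<close>
  have "rees_exp f w = (\<Sum>x\<in>?K. \<Sum>_<Poly_Mapping.lookup w x. rees_var f x)" if "w \<in> {u, v, u + v}" for w
    using that by (intro rees_exp_superset) (auto simp: keys_add_mono)
  then show ?thesis by (simp add: lookup_add sum_const_add sum.distrib)
qed

lemma rees_exp_sum: "rees_exp f (sum s A) = (\<Sum>a\<in>A. rees_exp f (s a))"
  by (induction A rule: infinite_finite_induct) (auto simp: rees_exp_add)

lemma rees_exp_indet [simp]: "rees_exp f (indet v) = rees_var f v"
  by (simp add: rees_exp_def indet_def)

lemma sum_const_indet: "(\<Sum>_<k. indet v) = Poly_Mapping.single v k"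
  by (induction k) (simp_all add: indet_def single_add [symmetric])

lemma rees_exp_eq_self:
  assumes "m \<in> mons (Xvars n)"
  shows "rees_exp f m = m"
proof -
  have "rees_exp f m = (\<Sum>v\<in>Poly_Mapping.keys m. Poly_Mapping.single v (Poly_Mapping.lookup m v))"
    unfolding rees_exp_def
  proof (rule sum.cong[OF refl])
    fix v assume "v \<in> Poly_Mapping.keys m"
    then obtain k where "v = Xv k" using assms by (auto simp: mons_def Xvars_def)
    then show "(\<Sum>_<Poly_Mapping.lookup m v. rees_var f v) = Poly_Mapping.single v (Poly_Mapping.lookup m v)"
      by (simp add: rees_var_def sum_const_indet)
  qed
  also have "\<dots> = m"
  proof (rule poly_mapping_eqI)
    fix x
    show "Poly_Mapping.lookup (\<Sum>v\<in>Poly_Mapping.keys m. Poly_Mapping.single v (Poly_Mapping.lookup m v)) x =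
      Poly_Mapping.lookup m x"
      by (simp add: lookup_sum lookup_single when_def in_keys_iff)
  qed
  finally show ?thesis .
qed

lemma monomial_0 [simp]: "monomial 0 = (1 :: 'k::field mpoly)"
  by (simp add: monomial_def)

lemma monomial_power: "(monomial u :: 'k::field mpoly) ^ k = monomial (\<Sum>_<k. u)"
  by (induction k) (simp_all add: monomial_mult add.commute)

lemma monomial_prod: "(\<Prod>a\<in>A. monomial (s a)) = (monomial (sum s A) :: 'k::field mpoly)"
  by (induction A rule: infinite_finite_induct) (simp_all add: monomial_mult)

text \<open>Substituting monomials for the indeterminates turns each monomial into a single
  monomial, so \<open>rees_map\<close> moves coefficients along \<open>rees_exp\<close> and adds
  those that land together.\<close>

lemma rees_map_eq:
  "rees_map f p = (\<Sum>m\<in>Poly_Mapping.keys p.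
     Poly_Mapping.single (rees_exp f m) (Poly_Mapping.lookup p m :: 'k::field))"
proof -
  have *: "(\<lambda>v. case v of
       Xv k \<Rightarrow> monomial (indet (Xv k))
     | Tv i j \<Rightarrow> monomial (f i j + indet (Yv i))
     | Yv i \<Rightarrow> monomial (indet (Yv i))) = (\<lambda>v. monomial (rees_var f v) :: 'k mpoly)"
    by (auto simp: rees_var_def split: indet_var.split)
  have "const_poly c * (monomial u :: 'k mpoly) = Poly_Mapping.single u c" for c u
    by (simp add: const_poly_def monomial_def mult_single)
  then show ?thesis
    by (simp add: rees_map_def * poly_subst_def monomial_power monomial_prod rees_exp_def)
qed

lemma lookup_rees_map:
  "Poly_Mapping.lookup (rees_map f p) z =
   (\<Sum>m\<in>Poly_Mapping.keys p. if rees_exp f m = z then Poly_Mapping.lookup p m else (0 :: 'k::field))"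
  by (simp add: rees_map_eq lookup_sum lookup_single when_def)

lemma rees_map_binomial:
  assumes "rees_exp f u = rees_exp f v"
  shows "rees_map f (monomial u - monomial v :: 'k::field mpoly) = 0"
\<comment> \<open>\<open>keys_binomial\<close> describes the support only for distinct monomials;
  equal ones cancel.\<close>
proof (cases "u = v")
  case True
  then show ?thesis by (simp add: rees_map_eq)
next
  case False
  show ?thesis
    by (rule poly_mapping_eqI)
      (use False assms in \<open>simp add: lookup_rees_map keys_binomial lookup_minus lookup_monomial\<close>)
qed

text \<open>The coefficients of a kernel element sum to zero over each fibre of \<open>rees_exp f\<close>.\<close>

lemma rees_map_0_partner:
  assumes "rees_map f p = (0 :: 'k::field mpoly)" "m \<in> Poly_Mapping.keys p"
  shows "\<exists>m'\<in>Poly_Mapping.keys p. m' \<noteq> m \<and> rees_exp f m' = rees_exp f m"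
proof (rule ccontr)
  assume "\<not> ?thesis"
  then have "Poly_Mapping.lookup (rees_map f p) (rees_exp f m) =
      (\<Sum>m'\<in>Poly_Mapping.keys p. if m' = m then Poly_Mapping.lookup p m' else 0)"
    unfolding lookup_rees_map by (intro sum.cong) auto
  with assms show False by (simp add: in_keys_iff)
qed

text \<open>Together with \<open>special_fiber_ideal_iff\<close> this shows that the special fiber
  ideal consists of those elements of the Rees ideal that contain no x-variable.\<close>

lemma rees_ideal_iff:
  "p \<in> rees_ideal n r \<mu> f I \<longleftrightarrow>
   Poly_Mapping.keys p \<subseteq> mons (Xvars n \<union> Tvars r \<mu>) \<and> rees_map f p = (0 :: 'k::field mpoly)"
  by (simp add: rees_ideal_def a_kernel_def' rees_algebra_def)

lemma special_fiber_ideal_iff: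
  "p \<in> special_fiber_ideal n r \<mu> f \<longleftrightarrow>
   Poly_Mapping.keys p \<subseteq> mons (Tvars r \<mu>) \<and> rees_map f p = (0 :: 'k::field mpoly)"
  by (simp add: special_fiber_ideal_def a_kernel_def' special_fiber_ring_def)

section \<open>Factorizations of monomials in the T-variables\<close>

text \<open>The exchange property speaks of indexed lists of factors. Induction on the degree,
  splitting off one variable at a time, brings a monomial into that shape, with \<open>w i\<close>
  factors of first index \<open>i\<close>.\<close>

lemma T_monomial_factorization:
  assumes "m \<in> mons (Tvars r \<mu>)"
  shows "\<exists>(w :: nat \<Rightarrow> nat) (\<alpha> :: nat \<Rightarrow> nat \<Rightarrow> nat). (\<forall>i\<in>{1..r}. \<forall>j\<in>{1..w i}. \<alpha> i j \<in> {1..\<mu> i}) \<and>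
    m = (\<Sum>i\<in>{1..r}. \<Sum>j\<in>{1..w i}. indet (Tv i (\<alpha> i j)))"
  using assms
proof (induction "mdeg m" arbitrary: m)
  case 0
  then have "m = 0" by (metis mdeg_eq_0_iff)
  then show ?case by (intro exI[of _ "\<lambda>_. 0"]) auto
next
  case (Suc k)
  then have "m \<noteq> 0" by (metis mdeg_eq_0_iff nat.distinct(1))
  then obtain x where x: "x \<in> Poly_Mapping.keys m" by (metis keys_eq_empty equals0I)
  with Suc.prems obtain i j where ij: "x = Tv i j" "i \<in> {1..r}" "j \<in> {1..\<mu> i}"
    by (auto simp: mons_def Tvars_def)
  from x have "mdvd (indet x) m"
    by (auto simp: mdvd_iff_lookup_le lookup_indet in_keys_iff)
  then obtain m' where m': "m = indet x + m'" by (auto simp: mdvd_def)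
  then have "k = mdeg m'" "m' \<in> mons (Tvars r \<mu>)" using Suc by (auto simp: mdeg_add)
  then obtain w :: "nat \<Rightarrow> nat" and \<alpha> :: "nat \<Rightarrow> nat \<Rightarrow> nat" where wa: "\<forall>i\<in>{1..r}. \<forall>j\<in>{1..w i}. \<alpha> i j \<in> {1..\<mu> i}"
    "m' = (\<Sum>i\<in>{1..r}. \<Sum>j\<in>{1..w i}. indet (Tv i (\<alpha> i j)))"
    using Suc.hyps(1)[of m'] by auto
  \<comment> \<open>The variable \<open>Tv i j\<close> that was split off is appended at position
    \<open>Suc (w i)\<close> of the list for \<open>i\<close>; all other entries stay as they
    are.\<close>
  define w' where "w' = w(i := Suc (w i))"
  define \<alpha>' where "\<alpha>' = \<alpha>(i := (\<alpha> i)(Suc (w i) := j))"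
  have same: "(\<Sum>j\<in>{1..w i}. indet (Tv i (\<alpha>' i j))) = (\<Sum>j\<in>{1..w i}. indet (Tv i (\<alpha> i j)))"
    by (rule sum.cong) (auto simp: \<alpha>'_def)
  have "(\<Sum>i\<in>{1..r} - {i}. \<Sum>j\<in>{1..w' i}. indet (Tv i (\<alpha>' i j))) =
        (\<Sum>i\<in>{1..r} - {i}. \<Sum>j\<in>{1..w i}. indet (Tv i (\<alpha> i j)))"
    by (rule sum.cong) (auto simp: \<alpha>'_def w'_def)
  moreover have "(\<Sum>j\<in>{1..w' i}. indet (Tv i (\<alpha>' i j))) = indet x + (\<Sum>j\<in>{1..w i}. indet (Tv i (\<alpha> i j)))"
    using same by (simp add: w'_def add.commute) (simp add: \<alpha>'_def ij)
  ultimately have "m = (\<Sum>i\<in>{1..r}. \<Sum>j\<in>{1..w' i}. indet (Tv i (\<alpha>' i j)))"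
    unfolding m' wa(2) by (simp only: sum.remove[OF _ ij(2)] finite_atLeastAtMost add.assoc)
  moreover have "\<forall>i\<in>{1..r}. \<forall>j\<in>{1..w' i}. \<alpha>' i j \<in> {1..\<mu> i}"
    using wa(1) ij by (auto simp: w'_def \<alpha>'_def le_Suc_eq)
  ultimately show ?case by blast
qed

text \<open>The exchange property returns the position of a factor; this shows that the variable at
  that position occurs in the monomial.\<close>

lemma lookup_T_factorization_pos:
  fixes w :: "nat \<Rightarrow> nat" and \<alpha> :: "nat \<Rightarrow> nat \<Rightarrow> nat"
  assumes "i \<in> {1..r}" "j \<in> {1..w i}"
  shows "0 < Poly_Mapping.lookup (\<Sum>i\<in>{1..r}. \<Sum>j\<in>{1..w i}. indet (Tv i (\<alpha> i j))) (Tv i (\<alpha> i j))"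
proof -
  have "(1::nat) \<le> (\<Sum>j'\<in>{1..w i}. Poly_Mapping.lookup (indet (Tv i (\<alpha> i j'))) (Tv i (\<alpha> i j)))"
    using member_le_sum[OF assms(2), of "\<lambda>j'. Poly_Mapping.lookup (indet (Tv i (\<alpha> i j'))) (Tv i (\<alpha> i j))"]
    by (simp add: lookup_indet)
  also have "\<dots> \<le> (\<Sum>i'\<in>{1..r}. \<Sum>j'\<in>{1..w i'}. Poly_Mapping.lookup (indet (Tv i' (\<alpha> i' j'))) (Tv i (\<alpha> i j)))"
    by (rule member_le_sum[OF assms(1), of "\<lambda>i'. \<Sum>j'\<in>{1..w i'}. Poly_Mapping.lookup (indet (Tv i' (\<alpha> i' j'))) (Tv i (\<alpha> i j))"]) auto
  finally show ?thesis by (simp add: lookup_sum)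
qed

lemma rees_exp_T_factorization:
  fixes w :: "nat \<Rightarrow> nat" and \<alpha> :: "nat \<Rightarrow> nat \<Rightarrow> nat"
  shows "rees_exp f (\<Sum>i\<in>{1..r}. \<Sum>j\<in>{1..w i}. indet (Tv i (\<alpha> i j))) =
   (\<Sum>i\<in>{1..r}. \<Sum>j\<in>{1..w i}. f i (\<alpha> i j) + indet (Yv i))"
  by (simp add: rees_exp_sum rees_var_def)

text \<open>The generators contain no Rees variable, so each factor of first index \<open>i\<close>
  contributes exactly one \<open>Yv i\<close>. Thus \<open>w\<close> can be read off the image
  alone.\<close>

lemma lookup_rees_exp_T_factorization_Y:
  fixes w :: "nat \<Rightarrow> nat" and \<alpha> :: "nat \<Rightarrow> nat \<Rightarrow> nat"
  assumes "i \<in> {1..r}" "\<And>i j. i \<in> {1..r} \<Longrightarrow> j \<in> {1..w i} \<Longrightarrow> f i (\<alpha> i j) \<in> mons (Xvars n)"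
  shows "Poly_Mapping.lookup (rees_exp f (\<Sum>i\<in>{1..r}. \<Sum>j\<in>{1..w i}. indet (Tv i (\<alpha> i j)))) (Yv i) = w i"
proof -
  have "Poly_Mapping.lookup (f i' (\<alpha> i' j)) (Yv i) = 0" if "i' \<in> {1..r}" "j \<in> {1..w i'}" for i' j
    using assms(2)[OF that] by (intro lookup_eq_0_if_mons) (auto simp: Xvars_def)
  then have "Poly_Mapping.lookup (rees_exp f (\<Sum>i\<in>{1..r}. \<Sum>j\<in>{1..w i}. indet (Tv i (\<alpha> i j)))) (Yv i) =
    (\<Sum>i'\<in>{1..r}. \<Sum>j\<in>{1..w i'}. if i' = i then 1 else 0)"
    unfolding rees_exp_T_factorization lookup_sum
    by (intro sum.cong refl) (simp add: lookup_add lookup_indet)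
  also have "\<dots> = (\<Sum>i'\<in>{1..r}. if i' = i then w i else 0)" by (intro sum.cong) auto
  also have "\<dots> = w i" using assms(1) by simp
  finally show ?thesis .
qed

section \<open>The extended order\<close>

definition mrestrict :: "indet_var set \<Rightarrow> mono \<Rightarrow> mono" where
  "mrestrict V m = (\<Sum>v\<in>Poly_Mapping.keys m \<inter> V. Poly_Mapping.single v (Poly_Mapping.lookup m v))"

lemma lookup_mrestrict:
  "Poly_Mapping.lookup (mrestrict V m) x = (if x \<in> V then Poly_Mapping.lookup m x else 0)"
  by (auto simp: mrestrict_def lookup_sum lookup_single when_def in_keys_iff)

lemma mrestrict_in_mons [simp]: "mrestrict V m \<in> mons V"
  by (auto simp: mons_def in_keys_iff lookup_mrestrict split: if_splits)

lemma mrestrict_add: "mrestrict V (u + v) = mrestrict V u + mrestrict V v"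
  by (rule poly_mapping_eqI) (simp add: lookup_mrestrict lookup_add)

lemma mrestrict_id: "m \<in> mons V \<Longrightarrow> mrestrict V m = m"
  by (rule poly_mapping_eqI) (simp add: lookup_mrestrict lookup_eq_0_if_mons)

lemma mrestrict_split:
  assumes "m \<in> mons (V \<union> W)" "V \<inter> W = {}"
  shows "m = mrestrict V m + mrestrict W m"
  by (rule poly_mapping_eqI)
    (use assms lookup_eq_0_if_mons[OF assms(1)] in \<open>auto simp: lookup_mrestrict lookup_add\<close>)

lemma Xvars_Tvars_disjoint [simp]: "Xvars n \<inter> Tvars r \<mu> = {}"
  by (auto simp: Xvars_def Tvars_def)

lemma Xv_in_Xvars [simp]: "Xv t \<in> Xvars n \<longleftrightarrow> t \<in> {1..n}"
  by (auto simp: Xvars_def)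

lemma Xv_notin_Tvars [simp]: "Xv t \<notin> Tvars r \<mu>"
  by (auto simp: Tvars_def)

lemma Tv_in_Tvars [simp]: "Tv i j \<in> Tvars r \<mu> \<longleftrightarrow> i \<in> {1..r} \<and> j \<in> {1..\<mu> i}"
  by (auto simp: Tvars_def)

section \<open>Lexicographic comparison of x-parts\<close>

text \<open>\<open>lex_less\<close> sees only the exponents of \<open>Xv 1\<close> to
  \<open>Xv n\<close>, so on monomials with further variables it is total only up to this
  equivalence.\<close>

definition X_eq :: "nat \<Rightarrow> mono \<Rightarrow> mono \<Rightarrow> bool" where
  "X_eq n u v \<longleftrightarrow> (\<forall>t\<in>{1..n}. Poly_Mapping.lookup u (Xv t) = Poly_Mapping.lookup v (Xv t))"

lemma lex_less_irrefl: "X_eq n u v \<Longrightarrow> \<not> lex_less n u v"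
  by (auto simp: lex_less_def X_eq_def)

lemma lex_less_trans:
  assumes "lex_less n u v" "lex_less n v w"
  shows "lex_less n u w"
proof -
  from assms obtain p q where
    p: "p \<in> {1..n}" "\<forall>t\<in>{1..<p}. Poly_Mapping.lookup u (Xv t) = Poly_Mapping.lookup v (Xv t)"
      "Poly_Mapping.lookup u (Xv p) < Poly_Mapping.lookup v (Xv p)" and
    q: "q \<in> {1..n}" "\<forall>t\<in>{1..<q}. Poly_Mapping.lookup v (Xv t) = Poly_Mapping.lookup w (Xv t)"
      "Poly_Mapping.lookup v (Xv q) < Poly_Mapping.lookup w (Xv q)"
    unfolding lex_less_def by blast
  \<comment> \<open>The first index at which \<open>u\<close> and \<open>w\<close> differ is the
    smaller of the two given ones.\<close>
  have "Poly_Mapping.lookup u (Xv (min p q)) < Poly_Mapping.lookup w (Xv (min p q))"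
    using p q by (cases p q rule: linorder_cases) (auto simp: min_def)
  moreover have "\<forall>t\<in>{1..<min p q}. Poly_Mapping.lookup u (Xv t) = Poly_Mapping.lookup w (Xv t)"
    using p(2) q(2) by auto
  moreover have "min p q \<in> {1..n}" using p(1) q(1) by auto
  ultimately show ?thesis unfolding lex_less_def by blast
qed

lemma lex_less_X_eq_left: "X_eq n u u' \<Longrightarrow> lex_less n u v \<longleftrightarrow> lex_less n u' v"
  unfolding lex_less_def X_eq_def by (intro bex_cong refl) auto

lemma lex_less_X_eq_right: "X_eq n v v' \<Longrightarrow> lex_less n u v \<longleftrightarrow> lex_less n u v'"
  unfolding lex_less_def X_eq_def by (intro bex_cong refl) auto

lemma lex_less_total: "lex_less n u v \<or> X_eq n u v \<or> lex_less n v u"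
proof (cases "X_eq n u v")
  case False
  define q where "q = (LEAST t. t \<in> {1..n} \<and> Poly_Mapping.lookup u (Xv t) \<noteq> Poly_Mapping.lookup v (Xv t))"
  have q: "q \<in> {1..n}" "Poly_Mapping.lookup u (Xv q) \<noteq> Poly_Mapping.lookup v (Xv q)"
    using False LeastI_ex[of "\<lambda>t. t \<in> {1..n} \<and> Poly_Mapping.lookup u (Xv t) \<noteq> Poly_Mapping.lookup v (Xv t)"]
    unfolding q_def X_eq_def by blast+
  have "\<forall>t\<in>{1..<q}. Poly_Mapping.lookup u (Xv t) = Poly_Mapping.lookup v (Xv t)"
    using not_less_Least[of _ "\<lambda>t. t \<in> {1..n} \<and> Poly_Mapping.lookup u (Xv t) \<noteq> Poly_Mapping.lookup v (Xv t)"] q(1)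
    unfolding q_def [symmetric] by fastforce
  with q show ?thesis unfolding lex_less_def by (metis linorder_neqE_nat)
qed simp

lemma lex_less_add: "lex_less n (u + w) (v + w) \<longleftrightarrow> lex_less n u v"
  by (simp add: lex_less_def lookup_add)

text \<open>The two membership conditions keep this a relation on the monomials in
  \<open>Xvars n \<union> V\<close>, as \<open>linear_order_on\<close> requires.\<close>

definition ext_order :: "nat \<Rightarrow> indet_var set \<Rightarrow> mono rel \<Rightarrow> mono rel" where
  "ext_order n V \<tau> = {(u, v). u \<in> mons (Xvars n \<union> V) \<and> v \<in> mons (Xvars n \<union> V) \<and>
     (lex_less n u v \<or> X_eq n u v \<and> (mrestrict V u, mrestrict V v) \<in> \<tau>)}"

lemma X_eq_mrestrict_eqI:
  assumes "u \<in> mons (Xvars n \<union> V)" "v \<in> mons (Xvars n \<union> V)" "X_eq n u v" "mrestrict V u = mrestrict V v"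
  shows "u = v"
proof (rule poly_mapping_eqI)
  fix x
  have "Poly_Mapping.lookup u x = Poly_Mapping.lookup v x" if "x \<in> V"
    using arg_cong[OF assms(4), of "\<lambda>m. Poly_Mapping.lookup m x"] that by (simp add: lookup_mrestrict)
  moreover have "Poly_Mapping.lookup u x = Poly_Mapping.lookup v x" if "x \<in> Xvars n"
    using assms(3) that by (auto simp: X_eq_def Xvars_def)
  ultimately show "Poly_Mapping.lookup u x = Poly_Mapping.lookup v x"
    using lookup_eq_0_if_mons[OF assms(1)] lookup_eq_0_if_mons[OF assms(2)] by (cases "x \<in> Xvars n \<union> V") auto
qed

lemma monomial_order_ext_order:
  assumes \<tau>: "monomial_order V \<tau>"
  shows "monomial_order (Xvars n \<union> V) (ext_order n V \<tau>)"
proof -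
  have lin: "\<And>u. u \<in> mons V \<Longrightarrow> (u, u) \<in> \<tau>" "trans \<tau>" "total_on (mons V) \<tau>" "antisym \<tau>"
    and zero: "\<And>u. u \<in> mons V \<Longrightarrow> (0, u) \<in> \<tau>"
    and add: "\<And>u v w. w \<in> mons V \<Longrightarrow> (u, v) \<in> \<tau> \<Longrightarrow> (u + w, v + w) \<in> \<tau>"
    using \<tau> by (auto simp: monomial_order_def order_on_defs refl_on_def)
  let ?E = "ext_order n V \<tau>" and ?M = "mons (Xvars n \<union> V)"
  have "?E \<subseteq> ?M \<times> ?M" by (auto simp: ext_order_def)
  moreover have "refl_on ?M ?E"
    using lin(1) by (auto simp: refl_on_def ext_order_def X_eq_def)
  moreover have "trans ?E"
  proof (rule transI)
    fix u v w assume "(u, v) \<in> ?E" "(v, w) \<in> ?E"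
    then show "(u, w) \<in> ?E"
      unfolding ext_order_def
      using lex_less_trans[of n u v w] lex_less_X_eq_left[of n u v w] lex_less_X_eq_right[of n v w u]
        transD[OF lin(2), of "mrestrict V u" "mrestrict V v" "mrestrict V w"]
      by (auto simp: X_eq_def)
  qed
  moreover have "antisym ?E"
  proof (rule antisymI)
    fix u v assume uv: "(u, v) \<in> ?E" "(v, u) \<in> ?E"
    \<comment> \<open>A strict lexicographic comparison in one direction contradicts the reverse
      hypothesis, by transitivity or by irreflexivity.\<close>
    then have "X_eq n u v"
      using lex_less_trans[of n u v u] lex_less_irrefl[of n u u] lex_less_irrefl[of n v u] lex_less_irrefl[of n u v]
      unfolding ext_order_def by (auto simp: X_eq_def)
    then have "\<not> lex_less n u v" "\<not> lex_less n v u"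
      using lex_less_irrefl[of n u v] lex_less_irrefl[of n v u] by (auto simp: X_eq_def)
    with uv have "mrestrict V u = mrestrict V v"
      using antisymD[OF lin(4)] by (auto simp: ext_order_def)
    with uv \<open>X_eq n u v\<close> show "u = v"
      by (auto simp: ext_order_def intro: X_eq_mrestrict_eqI)
  qed
  moreover have "total_on ?M ?E"
  proof (rule total_onI)
    fix u v assume "u \<in> ?M" "v \<in> ?M" "u \<noteq> v"
    moreover have "(mrestrict V u, mrestrict V v) \<in> \<tau> \<or> (mrestrict V v, mrestrict V u) \<in> \<tau>"
      using lin(1,3) by (cases "mrestrict V u = mrestrict V v") (auto simp: total_on_def)
    moreover have "X_eq n u v = X_eq n v u" by (auto simp: X_eq_def)
    ultimately show "(u, v) \<in> ?E \<or> (v, u) \<in> ?E"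
      using lex_less_total[of n u v] by (auto simp: ext_order_def)
  qed
  \<comment> \<open>Of the three cases of \<open>lex_less_total\<close>,
    \<open>lex_less n u 0\<close> is impossible, since it needs an exponent below zero.\<close>
  moreover have "(0, u) \<in> ?E" if "u \<in> ?M" for u
    using that lex_less_total[of n 0 u] zero[of "mrestrict V u"]
    by (auto simp: ext_order_def lex_less_def mrestrict_id)
  moreover have "(u + w, v + w) \<in> ?E" if "w \<in> ?M" "(u, v) \<in> ?E" for u v w
    using that add[of "mrestrict V w"]
    by (auto simp: ext_order_def lex_less_add mrestrict_add X_eq_def lookup_add)
  ultimately show ?thesis
    by (auto simp: monomial_order_def order_on_defs)
qed

text \<open>All exponents of x-variables vanish on both sides, so the lexicographic comparison is a
  tie and \<open>\<tau>\<close> decides.\<close>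

lemma ext_order_iff_on_mons:
  assumes "V \<inter> Xvars n = {}" "u \<in> mons V" "v \<in> mons V"
  shows "(u, v) \<in> ext_order n V \<tau> \<longleftrightarrow> (u, v) \<in> \<tau>"
proof -
  have "X_eq n u v"
    unfolding X_eq_def
  proof
    fix t assume "t \<in> {1..n}"
    then have "Xv t \<notin> V" using assms(1) by auto
    then show "Poly_Mapping.lookup u (Xv t) = Poly_Mapping.lookup v (Xv t)"
      using assms by (simp add: lookup_eq_0_if_mons)
  qed
  moreover from this have "\<not> lex_less n u v" by (rule lex_less_irrefl)
  moreover have "mons V \<subseteq> mons (Xvars n \<union> V)" by (rule mons_mono) auto
  ultimately show ?thesis using assms by (auto simp: ext_order_def mrestrict_id)
qed

lemma Restr_ext_order:
  assumes "monomial_order V \<tau>" "V \<inter> Xvars n = {}"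
  shows "Restr (ext_order n V \<tau>) (mons V) = \<tau>"
proof -
  have "\<tau> \<subseteq> mons V \<times> mons V"
    using assms(1) by (auto simp: monomial_order_def order_on_defs)
  then show ?thesis using ext_order_iff_on_mons[OF assms(2)] by auto
qed

text \<open>This lets the members of \<open>G\<close> keep their leading monomials when they are
  viewed in the larger ring.\<close>

lemma lead_mon_ext_order:
  assumes \<tau>: "monomial_order V \<tau>" and V: "V \<inter> Xvars n = {}"
    and p: "Poly_Mapping.keys p \<subseteq> mons V" "p \<noteq> (0 :: 'k::field mpoly)"
  shows "lead_mon (ext_order n V \<tau>) p = lead_mon \<tau> p"
  using lead_mon_max[OF \<tau> p(2,1)] p(1) ext_order_iff_on_mons[OF V]
  by (intro lead_mon_eqI[OF monomial_order_ext_order[OF \<tau>]]) blast+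

lemma mdeg_Xvars:
  assumes "m \<in> mons (Xvars n)"
  shows "mdeg m = (\<Sum>t\<in>{1..n}. Poly_Mapping.lookup m (Xv t))"
proof -
  have "mdeg m = (\<Sum>v\<in>Xvars n. Poly_Mapping.lookup m v)"
    using assms by (intro mdeg_superset) (auto simp: mons_def Xvars_def)
  then show ?thesis by (simp add: Xvars_def sum.reindex inj_on_def)
qed

section \<open>The exchange binomials\<close>

locale exchange_setting =
  fixes n r :: nat
    and \<mu> d :: "nat \<Rightarrow> nat"
    and f :: "nat \<Rightarrow> nat \<Rightarrow> mono"
    and I :: "nat \<Rightarrow> 'k::field mpoly set"
  assumes f_mons: "\<And>i j. i \<in> {1..r} \<Longrightarrow> j \<in> {1..\<mu> i} \<Longrightarrow> f i j \<in> mons (Xvars n)"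
    and gens: "\<And>i. i \<in> {1..r} \<Longrightarrow>
           minimal_monomial_gens (Xvars n) (I i) ((\<lambda>j. monomial (f i j)) ` {1..\<mu> i})"
    and f_deg: "\<And>i j. i \<in> {1..r} \<Longrightarrow> j \<in> {1..\<mu> i} \<Longrightarrow> mdeg (f i j) = d i"
    and f_lex: "\<And>i j j'. i \<in> {1..r} \<Longrightarrow> j \<in> {1..\<mu> i} \<Longrightarrow> j' \<in> {1..\<mu> i} \<Longrightarrow> j < j' \<Longrightarrow>
           lex_less n (f i j') (f i j)"
    and exchange: "strong_l_exchange n r \<mu> f I"
begin

text \<open>The generators of each ideal are listed in strictly decreasing lexicographic order,
  hence without repetition.\<close>

lemma f_inject:
  assumes "i \<in> {1..r}" "j \<in> {1..\<mu> i}" "j' \<in> {1..\<mu> i}" "f i j = f i j'"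
  shows "j = j'"
proof (rule ccontr)
  assume "j \<noteq> j'"
  then have "lex_less n (f i j) (f i j')"
    using f_lex[of i j j'] f_lex[of i j' j] assms by (metis linorder_neqE_nat)
  with assms(4) show False using lex_less_irrefl[of n "f i j" "f i j'"] by (simp add: X_eq_def)
qed

lemma monomial_in_I_iff:
  assumes "i \<in> {1..r}"
  shows "monomial g \<in> I i \<longleftrightarrow> g \<in> mons (Xvars n) \<and> (\<exists>j\<in>{1..\<mu> i}. mdvd (f i j) g)"
proof -
  have "I i = Idl\<^bsub>poly_ring (Xvars n)\<^esub> (monomial ` f i ` {1..\<mu> i})"
    using gens[OF assms] by (simp add: minimal_monomial_gens_def image_image)
  then show ?thesis
    using monomial_in_Idl_iff[of "f i ` {1..\<mu> i}" "Xvars n" g] f_mons[OF assms]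
    by (simp add: image_subset_iff)
qed

text \<open>By equigeneration, a quotient lying in the ideal is itself one of the generators.\<close>

lemma quot_in_iff:
  assumes i: "i \<in> {1..r}" and j: "j \<in> {1..\<mu> i}"
  shows "quot_in n (I i) (indet (Xv k1) + f i j) k2 \<longleftrightarrow>
    (\<exists>j'\<in>{1..\<mu> i}. indet (Xv k1) + f i j = indet (Xv k2) + f i j')"
proof
  assume "quot_in n (I i) (indet (Xv k1) + f i j) k2"
  then obtain g where g: "g + indet (Xv k2) = indet (Xv k1) + f i j" "monomial g \<in> I i"
    by (auto simp: quot_in_def)
  then obtain j' w where j': "j' \<in> {1..\<mu> i}" and w: "g = f i j' + w"
    using i by (auto simp: monomial_in_I_iff mdvd_def)
  have "mdeg g = d i"
    using arg_cong[OF g(1), of mdeg] f_deg[OF i j] by (simp add: mdeg_add)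
  then have "w = 0" using f_deg[OF i j'] w by (simp add: mdeg_add)
  with g(1) w j' show "\<exists>j'\<in>{1..\<mu> i}. indet (Xv k1) + f i j = indet (Xv k2) + f i j'"
    by (auto simp: add.commute intro!: bexI[of _ j'])
next
  assume "\<exists>j'\<in>{1..\<mu> i}. indet (Xv k1) + f i j = indet (Xv k2) + f i j'"
  then obtain j' where j': "j' \<in> {1..\<mu> i}" "indet (Xv k1) + f i j = indet (Xv k2) + f i j'" by blast
  moreover have "monomial (f i j') \<in> I i"
    using j'(1) f_mons[OF i j'(1)] mdvd_refl unfolding monomial_in_I_iff[OF i] by blast
  ultimately show "quot_in n (I i) (indet (Xv k1) + f i j) k2"
    unfolding quot_in_def using f_mons[OF i j'(1)]
    by (intro bexI[of _ "f i j'"]) (simp_all add: add.commute)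
qed

lemma exchange_binomialE:
  assumes "h \<in> exchange_binomials n r \<mu> f I"
  obtains i j j' k1 k2 where
    "h = monomial (indet (Xv k1) + indet (Tv i j)) - monomial (indet (Xv k2) + indet (Tv i j'))"
    "i \<in> {1..r}" "j \<in> {1..\<mu> i}" "j' \<in> {1..\<mu> i}" "k1 \<in> {1..n}" "k2 \<in> {1..n}" "k1 < k2"
    "indet (Xv k1) + f i j = indet (Xv k2) + f i j'"
    "k2 = Max {k \<in> {1..n}. quot_in n (I i) (indet (Xv k1) + f i j) k}"
  using assms unfolding exchange_binomials_def monomial_mult by blast

text \<open>The maximal admissible index is at least \<open>k\<close>, hence exceeds
  \<open>k1\<close>, and \<open>quot_in_iff\<close> turns the corresponding quotient into a
  generator. So every exchangeable factor yields an exchange binomial with a prescribed first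
  term.\<close>

lemma exchange_binomialI:
  assumes "i \<in> {1..r}" "j \<in> {1..\<mu> i}" "k1 \<in> {1..n}" "k \<in> {k1<..n}"
    "quot_in n (I i) (indet (Xv k1) + f i j) k"
  shows "\<exists>k2 j'. k1 < k2 \<and> k2 \<in> {1..n} \<and> j' \<in> {1..\<mu> i} \<and>
    monomial (indet (Xv k1) + indet (Tv i j)) - monomial (indet (Xv k2) + indet (Tv i j'))
      \<in> exchange_binomials n r \<mu> f I"
proof -
  let ?S = "{k \<in> {1..n}. quot_in n (I i) (indet (Xv k1) + f i j) k}"
  define k2 where "k2 = Max ?S"
  have "k \<in> ?S" using assms by auto
  then have k2: "k \<le> k2" "k2 \<in> ?S"
    unfolding k2_def using Max_ge[of ?S k] Max_in[of ?S] by (blast intro: finite_subset[of _ "{1..n}"])+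
  then obtain j' where j': "j' \<in> {1..\<mu> i}" "indet (Xv k1) + f i j = indet (Xv k2) + f i j'"
    using assms(1,2) by (auto simp: quot_in_iff)
  have "k1 < k2" "k2 \<in> {1..n}" using k2 assms(4) by auto
  with assms(1-3) j' k2_def have
    "monomial (indet (Xv k1)) * monomial (indet (Tv i j)) - monomial (indet (Xv k2)) * monomial (indet (Tv i j'))
      \<in> exchange_binomials n r \<mu> f I"
    unfolding exchange_binomials_def by blast
  with \<open>k1 < k2\<close> \<open>k2 \<in> {1..n}\<close> j'(1) show ?thesis unfolding monomial_mult by blast
qed

lemma finite_exchange_binomials: "finite (exchange_binomials n r \<mu> f I)"
proof -
  \<comment> \<open>The largest of the numbers \<open>\<mu> i\<close> bounds both generator indices,
    so all index tuples lie in one finite box.\<close>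
  let ?A = "{1..r} \<times> {1..Max (\<mu> ` {1..r})} \<times> {1..Max (\<mu> ` {1..r})} \<times> {1..n} \<times> {1..n}"
  have "j \<le> Max (\<mu> ` {1..r})" if "i \<in> {1..r}" "j \<in> {1..\<mu> i}" for i j
    using that order_trans[OF _ Max_ge[of "\<mu> ` {1..r}" "\<mu> i"]] by auto
  then have "exchange_binomials n r \<mu> f I \<subseteq>
    (\<lambda>(i, j, j', k1, k2). monomial (indet (Xv k1) + indet (Tv i j)) - monomial (indet (Xv k2) + indet (Tv i j'))) ` ?A"
    by (auto elim!: exchange_binomialE intro!: image_eqI[where x = "(_, _, _, _, _)"])
  then show ?thesis by (rule finite_subset) simp
qed

section \<open>Exchange within a fibre of the monomial map\<close>

text \<open>The x-part of \<open>m\<close> is fixed by \<open>rees_exp\<close>, while the T-part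
  becomes a product of generators and Rees variables. The exponents of \<open>Yv i\<close> then
  count the factors, and those of \<open>Xv t\<close> give a balance between the x-part and the
  generators.\<close>

lemma rees_exp_decomposition:
  assumes m: "m \<in> mons (Xvars n \<union> Tvars r \<mu>)"
  shows "\<exists>(w :: nat \<Rightarrow> nat) (\<alpha> :: nat \<Rightarrow> nat \<Rightarrow> nat).
    (\<forall>i\<in>{1..r}. \<forall>j\<in>{1..w i}. \<alpha> i j \<in> {1..\<mu> i}) \<and>
    (\<forall>i\<in>{1..r}. w i = Poly_Mapping.lookup (rees_exp f m) (Yv i)) \<and>
    (\<forall>t\<in>{1..n}. Poly_Mapping.lookup (rees_exp f m) (Xv t) = Poly_Mapping.lookup m (Xv t) +
       Poly_Mapping.lookup (\<Sum>i\<in>{1..r}. \<Sum>j\<in>{1..w i}. f i (\<alpha> i j)) (Xv t)) \<and>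
    mrestrict (Tvars r \<mu>) m = (\<Sum>i\<in>{1..r}. \<Sum>j\<in>{1..w i}. indet (Tv i (\<alpha> i j)))"
proof -
  have "mrestrict (Tvars r \<mu>) m \<in> mons (Tvars r \<mu>)" by simp
  from T_monomial_factorization[OF this]
  obtain w :: "nat \<Rightarrow> nat" and \<alpha> :: "nat \<Rightarrow> nat \<Rightarrow> nat"
    where wa: "\<forall>i\<in>{1..r}. \<forall>j\<in>{1..w i}. \<alpha> i j \<in> {1..\<mu> i}"
    and T: "mrestrict (Tvars r \<mu>) m = (\<Sum>i\<in>{1..r}. \<Sum>j\<in>{1..w i}. indet (Tv i (\<alpha> i j)))"
    by blast
  have split: "rees_exp f m = mrestrict (Xvars n) m + rees_exp f (mrestrict (Tvars r \<mu>) m)"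
    by (subst mrestrict_split[OF m]) (simp_all add: rees_exp_add rees_exp_eq_self[of _ n])
  have "w i = Poly_Mapping.lookup (rees_exp f m) (Yv i)" if "i \<in> {1..r}" for i
  proof -
    have "Poly_Mapping.lookup (mrestrict (Xvars n) m) (Yv i) = 0"
      by (auto simp: lookup_mrestrict Xvars_def)
    then show ?thesis
      unfolding split lookup_add T
      by (subst lookup_rees_exp_T_factorization_Y[OF that, of w f \<alpha> n]) (use wa f_mons in auto)
  qed
  moreover have "Poly_Mapping.lookup (rees_exp f m) (Xv t) = Poly_Mapping.lookup m (Xv t) +
       Poly_Mapping.lookup (\<Sum>i\<in>{1..r}. \<Sum>j\<in>{1..w i}. f i (\<alpha> i j)) (Xv t)" if "t \<in> {1..n}" for t
    unfolding split T rees_exp_T_factorization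
    using that by (simp add: lookup_add lookup_mrestrict lookup_sum lookup_indet)
  ultimately show ?thesis using wa T by blast
qed

text \<open>The images agree, so a larger exponent of \<open>Xv q\<close> in \<open>m\<close> forces
  a smaller one in the product of the generators belonging to \<open>m\<close>. This is the
  situation of the exchange property, and the factor that it returns supplies the divisor.\<close>

lemma lex_exchange:
  assumes m: "m \<in> mons (Xvars n \<union> Tvars r \<mu>)" "m' \<in> mons (Xvars n \<union> Tvars r \<mu>)"
    and eq: "rees_exp f m = rees_exp f m'" and less: "lex_less n m' m"
  shows "\<exists>i\<in>{1..r}. \<exists>j\<in>{1..\<mu> i}. \<exists>k1\<in>{1..n}. \<exists>k\<in>{k1<..n}.
    mdvd (indet (Xv k1) + indet (Tv i j)) m \<and> quot_in n (I i) (indet (Xv k1) + f i j) k"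
proof -
  obtain w :: "nat \<Rightarrow> nat" and \<alpha> :: "nat \<Rightarrow> nat \<Rightarrow> nat" where
    \<alpha>: "\<forall>i\<in>{1..r}. \<forall>j\<in>{1..w i}. \<alpha> i j \<in> {1..\<mu> i}"
    and w: "\<forall>i\<in>{1..r}. w i = Poly_Mapping.lookup (rees_exp f m) (Yv i)"
    and X: "\<forall>t\<in>{1..n}. Poly_Mapping.lookup (rees_exp f m) (Xv t) = Poly_Mapping.lookup m (Xv t) +
       Poly_Mapping.lookup (\<Sum>i\<in>{1..r}. \<Sum>j\<in>{1..w i}. f i (\<alpha> i j)) (Xv t)"
    and T: "mrestrict (Tvars r \<mu>) m = (\<Sum>i\<in>{1..r}. \<Sum>j\<in>{1..w i}. indet (Tv i (\<alpha> i j)))"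
    using rees_exp_decomposition[OF m(1)] by blast
  obtain w' :: "nat \<Rightarrow> nat" and \<beta> :: "nat \<Rightarrow> nat \<Rightarrow> nat" where
    \<beta>: "\<forall>i\<in>{1..r}. \<forall>j\<in>{1..w' i}. \<beta> i j \<in> {1..\<mu> i}"
    and w': "\<forall>i\<in>{1..r}. w' i = Poly_Mapping.lookup (rees_exp f m') (Yv i)"
    and X': "\<forall>t\<in>{1..n}. Poly_Mapping.lookup (rees_exp f m') (Xv t) = Poly_Mapping.lookup m' (Xv t) +
       Poly_Mapping.lookup (\<Sum>i\<in>{1..r}. \<Sum>j\<in>{1..w' i}. f i (\<beta> i j)) (Xv t)"
    using rees_exp_decomposition[OF m(2)] by blast
  \<comment> \<open>Equal exponents of \<open>Yv i\<close> give equal numbers of factors, so both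
    products can be indexed by the same \<open>w\<close>, as the exchange property demands.\<close>
  have ww: "w' i = w i" if "i \<in> {1..r}" for i using w w' eq that by simp
  define u where "u = (\<Sum>i\<in>{1..r}. \<Sum>j\<in>{1..w i}. f i (\<alpha> i j))"
  define v where "v = (\<Sum>i\<in>{1..r}. \<Sum>j\<in>{1..w i}. f i (\<beta> i j))"
  have v: "(\<Sum>i\<in>{1..r}. \<Sum>j\<in>{1..w' i}. f i (\<beta> i j)) = v"
    unfolding v_def using ww by (intro sum.cong) auto
  have bal: "Poly_Mapping.lookup m (Xv t) + Poly_Mapping.lookup u (Xv t) =
      Poly_Mapping.lookup m' (Xv t) + Poly_Mapping.lookup v (Xv t)" if "t \<in> {1..n}" for t
    using bspec[OF X that] bspec[OF X' that] eq unfolding v u_def [symmetric] by argo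
  have uv_mons: "u \<in> mons (Xvars n)" "v \<in> mons (Xvars n)"
    unfolding u_def v_def using \<alpha> \<beta> ww f_mons by (auto intro!: mons_sum)
  have "mdeg u = (\<Sum>i\<in>{1..r}. \<Sum>j\<in>{1..w i}. d i)"
    unfolding u_def mdeg_sum using \<alpha> f_deg by (intro sum.cong refl) auto
  moreover have "mdeg v = (\<Sum>i\<in>{1..r}. \<Sum>j\<in>{1..w i}. d i)"
    unfolding v_def mdeg_sum using \<beta> ww f_deg by (intro sum.cong refl) auto
  ultimately have deg: "mdeg u = mdeg v" by simp
  obtain q where q: "q \<in> {1..n}"
    "\<And>t. t \<in> {1..<q} \<Longrightarrow> Poly_Mapping.lookup m' (Xv t) = Poly_Mapping.lookup m (Xv t)"
    "Poly_Mapping.lookup m' (Xv q) < Poly_Mapping.lookup m (Xv q)"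
    using less unfolding lex_less_def by blast
  have before: "Poly_Mapping.lookup u (Xv t) = Poly_Mapping.lookup v (Xv t)" if "t \<in> {1..<q}" for t
    using q(1) q(2)[OF that] bal[of t] that by auto
  have at: "Poly_Mapping.lookup u (Xv q) < Poly_Mapping.lookup v (Xv q)"
    using q(3) bal[OF q(1)] by linarith
  \<comment> \<open>If the first difference occurred at the last variable, \<open>v\<close> would
    have larger degree than \<open>u\<close>, although equigeneration makes the degrees
    equal.\<close>
  have "q \<noteq> n"
  proof
    assume "q = n"
    have "(\<Sum>t\<in>{1..n}. Poly_Mapping.lookup u (Xv t)) < (\<Sum>t\<in>{1..n}. Poly_Mapping.lookup v (Xv t))"
    proof (rule sum_strict_mono_ex1)
      show "\<forall>t\<in>{1..n}. Poly_Mapping.lookup u (Xv t) \<le> Poly_Mapping.lookup v (Xv t)"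
      proof
        fix t assume "t \<in> {1..n}"
        then have "t \<in> {1..<q} \<or> t = q" using \<open>q = n\<close> by auto
        then show "Poly_Mapping.lookup u (Xv t) \<le> Poly_Mapping.lookup v (Xv t)"
          using before[of t] at by auto
      qed
    qed (use at q(1) in auto)
    then show False using deg by (simp add: mdeg_Xvars[OF uv_mons(1)] mdeg_Xvars[OF uv_mons(2)])
  qed
  then have q1: "q \<in> {1..n - 1}" using q(1) by auto
  have all: "\<forall>i\<in>{1..r}. \<forall>j\<in>{1..w i}. \<alpha> i j \<in> {1..\<mu> i} \<and> \<beta> i j \<in> {1..\<mu> i}"
    using \<alpha> \<beta> ww by auto
  have "\<forall>t\<in>{1..q - 1}. Poly_Mapping.lookup u (Xv t) = Poly_Mapping.lookup v (Xv t)"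
    using before by auto
  with exchange q1 all u_def v_def at have
    "\<exists>i\<in>{1..r}. \<exists>j\<in>{1..w i}. \<exists>q'\<in>{q<..n}. quot_in n (I i) (indet (Xv q) + f i (\<alpha> i j)) q'"
    unfolding strong_l_exchange_def by blast
  then obtain i j q' where ij: "i \<in> {1..r}" "j \<in> {1..w i}" "q' \<in> {q<..n}"
    "quot_in n (I i) (indet (Xv q) + f i (\<alpha> i j)) q'" by blast
  \<comment> \<open>The position \<open>j\<close> is translated into the variable
    \<open>Tv i (\<alpha> i j)\<close>, which occurs in \<open>m\<close>. The variable
    \<open>Xv q\<close> occurs in \<open>m\<close> as well, by \<open>q(3)\<close>.\<close>
  have "0 < Poly_Mapping.lookup (mrestrict (Tvars r \<mu>) m) (Tv i (\<alpha> i j))"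
    unfolding T using lookup_T_factorization_pos[of i r j w \<alpha>] ij(1,2) by blast
  then have "0 < Poly_Mapping.lookup m (Tv i (\<alpha> i j))"
    by (simp add: lookup_mrestrict split: if_splits)
  with q(3) have "mdvd (indet (Xv q) + indet (Tv i (\<alpha> i j))) m"
    by (auto simp: mdvd_iff_lookup_le lookup_add lookup_indet)
  with ij \<alpha> q(1) show ?thesis by blast
qed

text \<open>The exponents of the Rees variables force \<open>m'\<close> to have either no factor or
  exactly one, of first index \<open>i\<close>; injectivity of the list of generators then
  identifies that factor.\<close>

lemma T_fibre_trivial:
  assumes ij: "i \<in> {1..r}" "j \<in> {1..\<mu> i}" and m: "m = 0 \<or> m = indet (Tv i j)"
    and m': "m' \<in> mons (Tvars r \<mu>)" and eq: "rees_exp f m' = rees_exp f m"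
  shows "m' = m"
proof -
  have mons: "m' \<in> mons (Xvars n \<union> Tvars r \<mu>)" using m' by (auto simp: mons_def)
  obtain w :: "nat \<Rightarrow> nat" and \<alpha> :: "nat \<Rightarrow> nat \<Rightarrow> nat" where
    \<alpha>: "\<forall>i\<in>{1..r}. \<forall>j\<in>{1..w i}. \<alpha> i j \<in> {1..\<mu> i}"
    and w: "\<forall>i\<in>{1..r}. w i = Poly_Mapping.lookup (rees_exp f m') (Yv i)"
    and T: "mrestrict (Tvars r \<mu>) m' = (\<Sum>i\<in>{1..r}. \<Sum>j\<in>{1..w i}. indet (Tv i (\<alpha> i j)))"
    using rees_exp_decomposition[OF mons] by blast
  have m'_eq: "m' = (\<Sum>i\<in>{1..r}. \<Sum>j\<in>{1..w i}. indet (Tv i (\<alpha> i j)))"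
    using T by (simp add: mrestrict_id[OF m'])
  from m show ?thesis
  proof
    assume "m = 0"
    then have "w i' = 0" if "i' \<in> {1..r}" for i' using w eq that by simp
    then have "m' = 0" unfolding m'_eq by (intro sum.neutral) simp
    then show ?thesis using \<open>m = 0\<close> by simp
  next
    assume m: "m = indet (Tv i j)"
    have "Poly_Mapping.lookup (f i j) (Yv i') = 0" for i'
      using f_mons[OF ij] by (rule lookup_eq_0_if_mons) (auto simp: Xvars_def)
    then have w: "w i' = (if i' = i then 1 else 0)" if "i' \<in> {1..r}" for i'
      using bspec[OF w that] eq m by (simp add: rees_var_def lookup_add lookup_indet)
    have "m' = (\<Sum>i'\<in>{1..r}. if i' = i then indet (Tv i (\<alpha> i 1)) else 0)"
      unfolding m'_eq by (intro sum.cong) (auto simp: w)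
    then have m'_eq: "m' = indet (Tv i (\<alpha> i 1))" using ij by simp
    moreover have "\<alpha> i 1 \<in> {1..\<mu> i}" using \<alpha> ij(1) w[OF ij(1)] by auto
    moreover have "f i (\<alpha> i 1) = f i j" using eq m m'_eq by (simp add: rees_var_def)
    ultimately show ?thesis using f_inject[OF ij(1)] ij(2) m by blast
  qed
qed

text \<open>A divisor of this monomial without x-variables is either 1 or \<open>Tv i j\<close>. But
  a kernel element has a second term with the same image, which \<open>T_fibre_trivial\<close>
  excludes.\<close>

lemma special_fiber_not_mdvd:
  assumes g: "g \<in> special_fiber_ideal n r \<mu> f" "(m :: mono) \<in> Poly_Mapping.keys (g :: 'k mpoly)"
    and ij: "i \<in> {1..r}" "j \<in> {1..\<mu> i}"
  shows "\<not> mdvd m (indet (Xv k) + indet (Tv i j))"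
proof
  assume dvd: "mdvd m (indet (Xv k) + indet (Tv i j))"
  have K: "Poly_Mapping.keys g \<subseteq> mons (Tvars r \<mu>)" "rees_map f g = 0"
    using g(1) by (simp_all add: special_fiber_ideal_iff)
  have le: "Poly_Mapping.lookup m x \<le> (if x = Tv i j then 1 else 0)" for x
  proof (cases "x = Xv k")
    case True
    have "m \<in> mons (Tvars r \<mu>)" using K(1) g(2) by blast
    then show ?thesis using True by (simp add: lookup_eq_0_if_mons)
  next
    case False
    have "Poly_Mapping.lookup m x \<le> Poly_Mapping.lookup (indet (Xv k) + indet (Tv i j)) x"
      using dvd by (simp add: mdvd_iff_lookup_le)
    with False show ?thesis by (simp add: lookup_add lookup_indet)
  qed
  have "m = 0 \<or> m = indet (Tv i j)"
  proof (cases "Poly_Mapping.lookup m (Tv i j) = 0")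
    case True
    then have "m = 0" by (intro poly_mapping_eqI) (use le in \<open>force split: if_splits\<close>)
    then show ?thesis ..
  next
    case False
    have "m = indet (Tv i j)"
    proof (rule poly_mapping_eqI)
      fix x
      show "Poly_Mapping.lookup m x = Poly_Mapping.lookup (indet (Tv i j)) x"
        using le[of x] False by (cases "x = Tv i j") (auto simp: lookup_indet)
    qed
    then show ?thesis ..
  qed
  moreover obtain m' where "m' \<in> Poly_Mapping.keys g" "m' \<noteq> m" "rees_exp f m' = rees_exp f m"
    using rees_map_0_partner[OF K(2) g(2)] by blast
  ultimately show False using T_fibre_trivial[OF ij] K(1) by blast
qed

text \<open>Since \<open>k1 < k2\<close>, the exponents of \<open>Xv k1\<close> already decide the
  comparison, whatever the T-variables are.\<close>

lemma lead_mon_exchange_binomial: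
  assumes \<tau>: "monomial_order (Tvars r \<mu>) \<tau>"
    and "k1 \<in> {1..n}" "k2 \<in> {1..n}" "k1 < k2" "i \<in> {1..r}" "j \<in> {1..\<mu> i}" "j' \<in> {1..\<mu> i}"
  shows "lead_mon (ext_order n (Tvars r \<mu>) \<tau>)
      (monomial (indet (Xv k1) + indet (Tv i j)) - monomial (indet (Xv k2) + indet (Tv i j')) :: 'k mpoly) =
    indet (Xv k1) + indet (Tv i j)"
    "indet (Xv k1) + indet (Tv i j) \<noteq> indet (Xv k2) + indet (Tv i j')"
proof -
  let ?u = "indet (Xv k1) + indet (Tv i j)" and ?v = "indet (Xv k2) + indet (Tv i j')"
  have "lex_less n ?v ?u"
    unfolding lex_less_def using assms by (intro bexI[of _ k1]) (auto simp: lookup_add lookup_indet)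
  then show "?u \<noteq> ?v" using lex_less_irrefl[of n ?v ?u] by (auto simp: X_eq_def)
  with \<open>lex_less n ?v ?u\<close> assms show
    "lead_mon (ext_order n (Tvars r \<mu>) \<tau>) (monomial ?u - monomial ?v :: 'k mpoly) = ?u"
    by (intro lead_mon_binomial[OF monomial_order_ext_order[OF \<tau>]]) (auto simp: ext_order_def)
qed

section \<open>Groebner bases of the Rees ideal\<close>

lemma groebner_basis_extension:
  assumes \<tau>: "monomial_order (Tvars r \<mu>) \<tau>"
    and G: "groebner_basis (Tvars r \<mu>) \<tau> (special_fiber_ideal n r \<mu> f) G"
  shows "groebner_basis (Xvars n \<union> Tvars r \<mu>) (ext_order n (Tvars r \<mu>) \<tau>) (rees_ideal n r \<mu> f I)
           (exchange_binomials n r \<mu> f I \<union> G)"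
proof (rule groebner_basisI)
  let ?\<tau>' = "ext_order n (Tvars r \<mu>) \<tau>" and ?H = "exchange_binomials n r \<mu> f I"
  have disj: "Tvars r \<mu> \<inter> Xvars n = {}" using Xvars_Tvars_disjoint by blast
  have GK: "finite G" "G \<subseteq> special_fiber_ideal n r \<mu> f" "0 \<notin> G"
    using G by (auto simp: groebner_basis_def)
  show order: "monomial_order (Xvars n \<union> Tvars r \<mu>) ?\<tau>'"
    by (rule monomial_order_ext_order[OF \<tau>])
  show J: "Poly_Mapping.keys p \<subseteq> mons (Xvars n \<union> Tvars r \<mu>)" if "p \<in> rees_ideal n r \<mu> f I" for p
    using that by (simp add: rees_ideal_iff)
  show "finite (?H \<union> G)" using GK finite_exchange_binomials by simp
  have H: "h \<in> rees_ideal n r \<mu> f I \<and> h \<noteq> 0" if "h \<in> ?H" for h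
    using that
  proof (cases rule: exchange_binomialE)
    case (1 i j j' k1 k2)
    have "Poly_Mapping.keys h = {indet (Xv k1) + indet (Tv i j), indet (Xv k2) + indet (Tv i j')}"
      unfolding 1(1) by (rule keys_binomial[OF lead_mon_exchange_binomial(2)[OF \<tau> 1(5,6,7,2,3,4)]])
    moreover have "rees_exp f (indet (Xv k1) + indet (Tv i j)) = rees_exp f (indet (Xv k2) + indet (Tv i j'))"
      using 1(8) by (simp add: rees_exp_add rees_var_def add.assoc [symmetric])
    then have "rees_map f h = 0" unfolding 1(1) by (rule rees_map_binomial)
    ultimately show ?thesis using 1(2-6) by (auto simp: rees_ideal_iff)
  qed
  have "special_fiber_ideal n r \<mu> f \<subseteq> rees_ideal n r \<mu> f I"
    using mons_mono[of "Tvars r \<mu>" "Xvars n \<union> Tvars r \<mu>"]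
    unfolding subset_iff rees_ideal_iff special_fiber_ideal_iff by blast
  with GK H show "?H \<union> G \<subseteq> rees_ideal n r \<mu> f I" "0 \<notin> ?H \<union> G" by blast+
  fix p assume p: "p \<in> rees_ideal n r \<mu> f I" "p \<noteq> 0"
  define m where "m = lead_mon ?\<tau>' p"
  have m: "m \<in> Poly_Mapping.keys p" "\<And>m'. m' \<in> Poly_Mapping.keys p \<Longrightarrow> (m', m) \<in> ?\<tau>'"
    using lead_mon_max[OF order p(2) J[OF p(1)]] by (auto simp: m_def)
  obtain m' where m': "m' \<in> Poly_Mapping.keys p" "m' \<noteq> m" "rees_exp f m' = rees_exp f m"
    using rees_map_0_partner[OF _ m(1)] p(1) unfolding rees_ideal_iff by blast
  have mons: "m \<in> mons (Xvars n \<union> Tvars r \<mu>)" "m' \<in> mons (Xvars n \<union> Tvars r \<mu>)"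
    using m(1) m'(1) J[OF p(1)] by blast+
  \<comment> \<open>The partner \<open>m'\<close> is at most \<open>m\<close>, which leaves two
    cases: a smaller x-part, settled by an exchange binomial, or equal x-parts, settled by an
    element of \<open>G\<close>.\<close>
  consider "lex_less n m' m" |
    "X_eq n m' m" "(mrestrict (Tvars r \<mu>) m', mrestrict (Tvars r \<mu>) m) \<in> \<tau>"
    using m(2)[OF m'(1)] by (auto simp: ext_order_def)
  then show "\<exists>g\<in>?H \<union> G. mdvd (lead_mon ?\<tau>' g) (lead_mon ?\<tau>' p)"
  proof cases
    case 1
    obtain i j k1 k where ij: "i \<in> {1..r}" "j \<in> {1..\<mu> i}" "k1 \<in> {1..n}" "k \<in> {k1<..n}"
      and dvd: "mdvd (indet (Xv k1) + indet (Tv i j)) m"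
      and quot: "quot_in n (I i) (indet (Xv k1) + f i j) k"
      using lex_exchange[OF mons m'(3)[symmetric] 1] by blast
    obtain k2 j' where k2: "k1 < k2" "k2 \<in> {1..n}" "j' \<in> {1..\<mu> i}"
      and "monomial (indet (Xv k1) + indet (Tv i j)) - monomial (indet (Xv k2) + indet (Tv i j')) \<in> ?H"
      using exchange_binomialI[OF ij quot] by blast
    then show ?thesis
      using lead_mon_exchange_binomial(1)[OF \<tau> ij(3) k2(2,1) ij(1,2) k2(3)] dvd
      unfolding m_def [symmetric] by (intro bexI[rotated]) auto
  next
    case 2
    let ?t = "mrestrict (Tvars r \<mu>) m" and ?t' = "mrestrict (Tvars r \<mu>) m'"
    let ?b = "monomial ?t - monomial ?t' :: 'k mpoly"
    have X: "mrestrict (Xvars n) m' = mrestrict (Xvars n) m"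
      using 2(1) by (intro poly_mapping_eqI) (auto simp: lookup_mrestrict X_eq_def Xvars_def)
    have ne: "?t \<noteq> ?t'" using X_eq_mrestrict_eqI[OF mons(2,1) 2(1)] m'(2) by auto
    \<comment> \<open>The common x-part cancels from the equal images of \<open>m\<close> and
      \<open>m'\<close>, which puts \<open>?b\<close> into the special fiber ideal.\<close>
    have "rees_exp f ?t = rees_exp f ?t'"
      using m'(3) X mrestrict_split[OF mons(1)] mrestrict_split[OF mons(2)]
      by (metis Xvars_Tvars_disjoint add_left_imp_eq rees_exp_add)
    then have "?b \<in> special_fiber_ideal n r \<mu> f"
      by (simp add: special_fiber_ideal_iff rees_map_binomial keys_binomial[OF ne])
    moreover have "?b \<noteq> 0" using keys_binomial[OF ne, where 'k='k] by (metis insert_not_empty keys_zero)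
    ultimately obtain g where g: "g \<in> G" "mdvd (lead_mon \<tau> g) (lead_mon \<tau> ?b)"
      using groebner_basisD[OF \<tau> _ G] unfolding special_fiber_ideal_iff by blast
    have "lead_mon \<tau> ?b = ?t" by (rule lead_mon_binomial[OF \<tau> _ 2(2) ne]) simp
    moreover have "mdvd ?t m" by (simp add: mdvd_iff_lookup_le lookup_mrestrict)
    moreover have "lead_mon ?\<tau>' g = lead_mon \<tau> g"
    proof (rule lead_mon_ext_order[OF \<tau> disj])
      show "Poly_Mapping.keys g \<subseteq> mons (Tvars r \<mu>)"
        using g(1) GK(2) special_fiber_ideal_iff by blast
    qed (use g(1) GK(3) in blast)
    ultimately show ?thesis using g mdvd_trans unfolding m_def [symmetric] by (metis UnI2)
  qed
qed

text \<open>Four pairings are checked, according to whether each of \<open>g\<close> and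
  \<open>h\<close> is an exchange binomial or an element of \<open>G\<close>; the hypothesis settles
  the pairing within \<open>G\<close>.\<close>

lemma reduced_groebner_basis_extension:
  assumes \<tau>: "monomial_order (Tvars r \<mu>) \<tau>"
    and G: "reduced_groebner_basis (Tvars r \<mu>) \<tau> (special_fiber_ideal n r \<mu> f) G"
  shows "reduced_groebner_basis (Xvars n \<union> Tvars r \<mu>) (ext_order n (Tvars r \<mu>) \<tau>) (rees_ideal n r \<mu> f I)
           (exchange_binomials n r \<mu> f I \<union> G)"
proof -
  let ?\<tau>' = "ext_order n (Tvars r \<mu>) \<tau>" and ?H = "exchange_binomials n r \<mu> f I"
  have disj: "Tvars r \<mu> \<inter> Xvars n = {}" using Xvars_Tvars_disjoint by blast
  have GB: "groebner_basis (Tvars r \<mu>) \<tau> (special_fiber_ideal n r \<mu> f) G"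
    and lc: "\<And>g. g \<in> G \<Longrightarrow> Poly_Mapping.lookup g (lead_mon \<tau> g) = 1"
    and red: "\<And>g h m. g \<in> G \<Longrightarrow> h \<in> G - {g} \<Longrightarrow> m \<in> Poly_Mapping.keys g \<Longrightarrow> \<not> mdvd (lead_mon \<tau> h) m"
    using G by (auto simp: reduced_groebner_basis_def)
  have GK: "g \<in> special_fiber_ideal n r \<mu> f" "g \<noteq> 0" "Poly_Mapping.keys g \<subseteq> mons (Tvars r \<mu>)" if "g \<in> G" for g
    using GB that special_fiber_ideal_iff[of g n r \<mu> f] unfolding groebner_basis_def by blast+
  have lead: "lead_mon ?\<tau>' g = lead_mon \<tau> g" "lead_mon \<tau> g \<in> Poly_Mapping.keys g" if "g \<in> G" for g
    using lead_mon_ext_order[OF \<tau> disj] lead_mon_max[OF \<tau>] GK[OF that] by blast+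
  have Hlead: "lead_mon ?\<tau>' h = indet (Xv k1) + indet (Tv i j)"
    if "h = monomial (indet (Xv k1) + indet (Tv i j)) - monomial (indet (Xv k2) + indet (Tv i j'))"
      "i \<in> {1..r}" "j \<in> {1..\<mu> i}" "j' \<in> {1..\<mu> i}" "k1 \<in> {1..n}" "k2 \<in> {1..n}" "k1 < k2"
    for h :: "'k mpoly" and i j j' k1 k2
    unfolding that(1) using that by (intro lead_mon_exchange_binomial(1)[OF \<tau>])
  have "Poly_Mapping.lookup h (lead_mon ?\<tau>' h) = 1" if "h \<in> ?H" for h
    using that
  proof (cases rule: exchange_binomialE)
    case (1 i j j' k1 k2)
    show ?thesis
      using lead_mon_exchange_binomial(2)[OF \<tau> 1(5,6,7,2,3,4)]
      unfolding Hlead[OF 1(1-7)] by (simp add: 1(1) lookup_minus lookup_monomial)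
  qed
  then have "\<forall>g\<in>?H \<union> G. Poly_Mapping.lookup g (lead_mon ?\<tau>' g) = 1"
    using lc lead by auto
  moreover have "\<not> mdvd (lead_mon ?\<tau>' h) m"
    if g: "g \<in> ?H \<union> G" and h: "h \<in> ?H \<union> G - {g}" and m: "m \<in> Poly_Mapping.keys g" for g h m
  proof (cases "g \<in> ?H")
    case True
    then show ?thesis
    proof (cases rule: exchange_binomialE)
      case (1 i j j' k1 k2)
      have m_cases: "m = indet (Xv k1) + indet (Tv i j) \<or> m = indet (Xv k2) + indet (Tv i j')"
        using m keys_binomial[OF lead_mon_exchange_binomial(2)[OF \<tau> 1(5,6,7,2,3,4)], where 'k='k]
        unfolding 1(1) by auto
      show ?thesis
      proof (cases "h \<in> G")
        case True
        have "\<not> mdvd (lead_mon \<tau> h) (indet (Xv k) + indet (Tv i c))" if "c \<in> {1..\<mu> i}" for k c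
          by (rule special_fiber_not_mdvd[OF GK(1)[OF True] lead(2)[OF True] 1(2) that])
        then show ?thesis using lead(1)[OF True] m_cases 1(3,4) by metis
      next
        case False
        with h have "h \<in> ?H" by blast
        then show ?thesis
        proof (cases rule: exchange_binomialE)
          case h: (1 a b b' l1 l2)
          show ?thesis
          proof
            assume "mdvd (lead_mon ?\<tau>' h) m"
            then have dvd: "mdvd (indet (Xv l1) + indet (Tv a b)) m"
              unfolding Hlead[OF h(1-7)] .
            \<comment> \<open>Both monomials consist of one x-variable and one T-variable, so
              comparing exponents at \<open>Xv l1\<close> and \<open>Tv a b\<close> identifies
              them.\<close>
            have var: "l1 = k \<and> a = i \<and> b = c" if "mdvd (indet (Xv l1) + indet (Tv a b)) (indet (Xv k) + indet (Tv i c))" for k c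
              using that[unfolded mdvd_iff_lookup_le, rule_format, of "Xv l1"]
                that[unfolded mdvd_iff_lookup_le, rule_format, of "Tv a b"]
              by (auto simp: lookup_add lookup_indet split: if_splits)
            from m_cases show False
            proof
              assume "m = indet (Xv k1) + indet (Tv i j)"
              with dvd var have eq: "l1 = k1" "a = i" "b = j" by auto
              \<comment> \<open>Both indices are the maximum of the same set, and cancelling the
                common x-variable equates the remaining generators. Hence the leading monomial
                determines the exchange binomial.\<close>
              then have "l2 = k2" using h(9) 1(9) by simp
              moreover from this eq have "f i b' = f i j'" using h(8) 1(8) by simp
              then have "b' = j'" using f_inject[of i b' j'] h(4) 1(2,4) eq by blast
              ultimately have "h = g" using h(1) 1(1) eq by simp
              then show False using \<open>h \<in> ?H \<union> G - {g}\<close> by simp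
            next
              assume "m = indet (Xv k2) + indet (Tv i j')"
              with dvd var have eq: "l1 = k2" "a = i" "b = j'" by auto
              \<comment> \<open>Chaining the relations of \<open>g\<close> and \<open>h\<close>
                gives another factorization of \<open>indet (Xv k1) + f i j\<close>, so
                \<open>l2\<close> competes in the maximum defining \<open>k2\<close>; but
                \<open>l2\<close> exceeds \<open>l1\<close>, which is \<open>k2\<close>.\<close>
              then have "quot_in n (I i) (indet (Xv k1) + f i j) l2"
                using h(4,8) 1(2,3,8) by (auto simp: quot_in_iff)
              then have "l2 \<le> k2"
                unfolding 1(9) using h(6) by (intro Max_ge) auto
              then show False using h(7) eq by simp
            qed
          qed
        qed
      qed
    qed
  next
    case False
    with g have gG: "g \<in> G" by blast
    show ?thesis
    proof (cases "h \<in> G")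
      case True
      then show ?thesis using red[OF gG _ m] h lead(1)[OF True] by auto
    next
      case False
      with h have "h \<in> ?H" by blast
      then show ?thesis
      proof (cases rule: exchange_binomialE)
        case (1 i j j' k1 k2)
        \<comment> \<open>No term of \<open>g\<close> contains an x-variable, whereas the leading
          monomial of \<open>h\<close> contains \<open>Xv k1\<close>.\<close>
        have "m \<in> mons (Tvars r \<mu>)" using GK(3)[OF gG] m by blast
        then have "\<not> mdvd (indet (Xv k1) + indet (Tv i j)) m"
          using mdvd_in_mons[of _ m "Tvars r \<mu>"] by fastforce
        then show ?thesis unfolding Hlead[OF 1(1-7)] .
      qed
    qed
  qed
  ultimately show ?thesis
    unfolding reduced_groebner_basis_def
    using groebner_basis_extension[OF \<tau> GB] by blast
qed

end

theorem theorem2p5: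
  fixes n r :: nat
    and \<mu> d :: "nat \<Rightarrow> nat"
    and f :: "nat \<Rightarrow> nat \<Rightarrow> mono"
    and I :: "nat \<Rightarrow> 'k::field mpoly set"
    and \<tau> :: "mono rel"
    and G :: "'k mpoly set"
  assumes "r \<ge> 1"
    and "\<And>i j. i \<in> {1..r} \<Longrightarrow> j \<in> {1..\<mu> i} \<Longrightarrow> f i j \<in> mons (Xvars n)"
    and "\<And>i. i \<in> {1..r} \<Longrightarrow>
           minimal_monomial_gens (Xvars n) (I i) ((\<lambda>j. monomial (f i j)) ` {1..\<mu> i})"
    and "\<And>i j. i \<in> {1..r} \<Longrightarrow> j \<in> {1..\<mu> i} \<Longrightarrow> mdeg (f i j) = d i"
    and "\<And>i j j'. i \<in> {1..r} \<Longrightarrow> j \<in> {1..\<mu> i} \<Longrightarrow> j' \<in> {1..\<mu> i} \<Longrightarrow> j < j' \<Longrightarrow>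
           lex_less n (f i j') (f i j)"
    and "strong_l_exchange n r \<mu> f I"
    and "monomial_order (Tvars r \<mu>) \<tau>"
    and "groebner_basis (Tvars r \<mu>) \<tau> (special_fiber_ideal n r \<mu> f) G"
  shows "\<exists>\<tau>'. monomial_order (Xvars n \<union> Tvars r \<mu>) \<tau>' \<and>
           Restr \<tau>' (mons (Tvars r \<mu>)) = \<tau> \<and>
           groebner_basis (Xvars n \<union> Tvars r \<mu>) \<tau>' (rees_ideal n r \<mu> f I)
             (exchange_binomials n r \<mu> f I \<union> G) \<and>
           (reduced_groebner_basis (Tvars r \<mu>) \<tau> (special_fiber_ideal n r \<mu> f) G \<longrightarrow>
            reduced_groebner_basis (Xvars n \<union> Tvars r \<mu>) \<tau>' (rees_ideal n r \<mu> f I)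
              (exchange_binomials n r \<mu> f I \<union> G))"
proof -
  interpret exchange_setting n r \<mu> d f I
    by unfold_locales (fact assms)+
  have "Tvars r \<mu> \<inter> Xvars n = {}" using Xvars_Tvars_disjoint by blast
  with assms(7,8) show ?thesis
    by (intro exI[of _ "ext_order n (Tvars r \<mu>) \<tau>"] conjI impI monomial_order_ext_order
        Restr_ext_order groebner_basis_extension reduced_groebner_basis_extension)
qed

end
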